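(* Let $S_n$ be the star with $n$ edges and let $D_k(S_n)\subset U_k^{top}(S_n)$ be the space of regular $k$-point configurations in $S_n$. Then $D_k(S_n)$ is a one-dimensional polyhedron, i.e., a graph.
   Context: The star $S_n$ is the graph on $n+1$ vertices with one vertex $v_0$ of degree $n$ and $n$ vertices $v_1,\dots,v_n$ of degree one. It carries the metric $d(x,y)=\kappa\rho(x,y)$, where $\rho$ is the standard simplicial metric on $S_n$ (every edge has length one) and $\kappa$ is a fixed constant with $\kappa\ge k-1$; thus $d(v_0,v_i)=\kappa$ for $i>0$ and $d(v_i,v_j)=2\kappa$ for $1\le i<j\le n$. The unordered $k$-point configuration space of a space $X$ is $U_k^{top}(X)=\{c\subset X: |c|=k\}$, with the quotient topology from $X^k-\Delta(X)$ under $(x_1,\dots,x_k)\mapsto\{x_1,\dots,x_k\}$, where $\Delta(X)$ is the fat diagonal, the set of $k$-tuples with $x_i=x_j$ for some $i\ne j$. For $x,y\in S_n$, $[x,y]$ denotes the geodesic segment joining them. A finite subset $c\subset S_n$ is a chain if $|c\cap[x,y]|=1+d(x,y)$ for all $x,y\in c$. For $c\subset S_n$ put $A_i(c)=c\cap[v_0,v_i]$ ($1\le i\le n$); the nonempty sets $A_i(c)$ are called the arms of $c$. A configuration $c$ is regular if there is an arm $A_m(c)$, called a governing arm, such that $A_m(c)\cup A_i(c)$ is a chain for all $i$, and there are at least two arms of $c$. Finally $D_k(S_n)=\{c\in U_k^{top}(S_n): c\text{ is regular}\}$. *)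

theory Defs
  imports "HOL-Analysis.Analysis"
begin

section \<open>Simplicial complexes and polyhedra\<close>

text \<open>Complexes need not be finite and polyhedra need not be compact: a half-open arc, for
  instance, is triangulated by a one-way infinite path.\<close>

definition abstract_complex :: "'v set set \<Rightarrow> bool" where
  "abstract_complex K \<longleftrightarrow>
     (\<forall>\<sigma>\<in>K. finite \<sigma> \<and> \<sigma> \<noteq> {} \<and> (\<forall>\<tau>. \<tau> \<noteq> {} \<and> \<tau> \<subseteq> \<sigma> \<longrightarrow> \<tau> \<in> K))"

text \<open>Points of the realization are given by their barycentric coordinates.\<close>

definition closed_simplex :: "'v set \<Rightarrow> ('v \<Rightarrow> real) set" where
  "closed_simplex \<sigma> = {x. (\<forall>v. 0 \<le> x v) \<and> (\<forall>v. v \<notin> \<sigma> \<longrightarrow> x v = 0) \<and> sum x \<sigma> = 1}"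

text \<open>The realization has the weak topology. Each closed simplex, whose vertex set is finite,
  gets its Euclidean topology from the product topology on the function space.\<close>

definition realization :: "'v set set \<Rightarrow> ('v \<Rightarrow> real) topology" where
  "realization K = topology (\<lambda>U. U \<subseteq> (\<Union>\<sigma>\<in>K. closed_simplex \<sigma>) \<and>
     (\<forall>\<sigma>\<in>K. openin (top_of_set (closed_simplex \<sigma>)) (U \<inter> closed_simplex \<sigma>)))"

lemma openin_realization:
  "openin (realization K) U \<longleftrightarrow> U \<subseteq> (\<Union>\<sigma>\<in>K. closed_simplex \<sigma>) \<and>
     (\<forall>\<sigma>\<in>K. openin (top_of_set (closed_simplex \<sigma>)) (U \<inter> closed_simplex \<sigma>))"
proof -
  have "istopology (\<lambda>U. U \<subseteq> (\<Union>\<sigma>\<in>K. closed_simplex \<sigma>) \<and>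
     (\<forall>\<sigma>\<in>K. openin (top_of_set (closed_simplex \<sigma>)) (U \<inter> closed_simplex \<sigma>)))"
    unfolding istopology_def
  proof (intro conjI allI impI ballI)
    fix S T \<sigma>
    assume S: "S \<subseteq> (\<Union>\<sigma>\<in>K. closed_simplex \<sigma>) \<and>
       (\<forall>\<sigma>\<in>K. openin (top_of_set (closed_simplex \<sigma>)) (S \<inter> closed_simplex \<sigma>))"
      and T: "T \<subseteq> (\<Union>\<sigma>\<in>K. closed_simplex \<sigma>) \<and>
       (\<forall>\<sigma>\<in>K. openin (top_of_set (closed_simplex \<sigma>)) (T \<inter> closed_simplex \<sigma>))"
      and "\<sigma> \<in> K"
    then have "openin (top_of_set (closed_simplex \<sigma>))
        ((S \<inter> closed_simplex \<sigma>) \<inter> (T \<inter> closed_simplex \<sigma>))"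
      by (meson openin_Int)
    moreover have "(S \<inter> closed_simplex \<sigma>) \<inter> (T \<inter> closed_simplex \<sigma>) = S \<inter> T \<inter> closed_simplex \<sigma>"
      by blast
    ultimately show "openin (top_of_set (closed_simplex \<sigma>)) (S \<inter> T \<inter> closed_simplex \<sigma>)"
      by simp
  next
    fix \<U> \<sigma>
    assume \<U>: "\<forall>U\<in>\<U>. U \<subseteq> (\<Union>\<sigma>\<in>K. closed_simplex \<sigma>) \<and>
       (\<forall>\<sigma>\<in>K. openin (top_of_set (closed_simplex \<sigma>)) (U \<inter> closed_simplex \<sigma>))"
      and "\<sigma> \<in> K"
    then have "openin (top_of_set (closed_simplex \<sigma>)) (\<Union>U\<in>\<U>. U \<inter> closed_simplex \<sigma>)"
      by (intro openin_Union) auto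
    then show "openin (top_of_set (closed_simplex \<sigma>)) (\<Union>\<U> \<inter> closed_simplex \<sigma>)"
      by (simp add: Int_commute Int_Union)
  qed auto
  then show ?thesis
    by (simp add: realization_def topology_inverse')
qed

text \<open>Vertices are natural numbers, so these are the countable complexes.\<close>

definition polyhedron_of_dim_le :: "nat \<Rightarrow> 'a topology \<Rightarrow> bool" where
  "polyhedron_of_dim_le d X \<longleftrightarrow>
     (\<exists>K :: nat set set. abstract_complex K \<and> (\<forall>\<sigma>\<in>K. card \<sigma> \<le> d + 1) \<and>
        X homeomorphic_space realization K)"

definition polyhedron_of_dim :: "nat \<Rightarrow> 'a topology \<Rightarrow> bool" where
  "polyhedron_of_dim d X \<longleftrightarrow>
     (\<exists>K :: nat set set. abstract_complex K \<and> (\<forall>\<sigma>\<in>K. card \<sigma> \<le> d + 1) \<and>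
        (\<exists>\<sigma>\<in>K. card \<sigma> = d + 1) \<and> X homeomorphic_space realization K)"

text \<open>A graph may have isolated vertices or be empty.\<close>

abbreviation topological_graph :: "'a topology \<Rightarrow> bool" where
  "topological_graph X \<equiv> polyhedron_of_dim_le 1 X"

section \<open>Unordered configuration spaces\<close>

definition configs :: "nat \<Rightarrow> 'a set \<Rightarrow> 'a set set" where
  "configs k X = {c. c \<subseteq> X \<and> finite c \<and> card c = k}"

definition fat_diagonal :: "nat \<Rightarrow> 'a set \<Rightarrow> (nat \<Rightarrow> 'a) set" where
  "fat_diagonal k X = {x \<in> {1..k} \<rightarrow>\<^sub>E X. \<exists>i\<in>{1..k}. \<exists>j\<in>{1..k}. i \<noteq> j \<and> x i = x j}"

definition ordered_config_topology :: "nat \<Rightarrow> 'a topology \<Rightarrow> (nat \<Rightarrow> 'a) topology" where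
  "ordered_config_topology k X =
     subtopology (product_topology (\<lambda>_. X) {1..k})
       (({1..k} \<rightarrow>\<^sub>E topspace X) - fat_diagonal k (topspace X))"

definition config_topology :: "nat \<Rightarrow> 'a topology \<Rightarrow> 'a set topology" where
  "config_topology k X = topology (\<lambda>U. U \<subseteq> configs k (topspace X) \<and>
     openin (ordered_config_topology k X)
       {x \<in> topspace (ordered_config_topology k X). x ` {1..k} \<in> U})"

lemma topspace_ordered_config_topology:
  "topspace (ordered_config_topology k X) =
     {x \<in> {1..k} \<rightarrow>\<^sub>E topspace X. inj_on x {1..k}}"
  by (auto simp: ordered_config_topology_def fat_diagonal_def inj_on_def)

lemma openin_config_topology:
  "openin (config_topology k X) U \<longleftrightarrow> U \<subseteq> configs k (topspace X) \<and>
     openin (ordered_config_topology k X)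
       {x \<in> topspace (ordered_config_topology k X). x ` {1..k} \<in> U}"
proof -
  let ?O = "ordered_config_topology k X"
  let ?pre = "\<lambda>U. {x \<in> topspace ?O. x ` {1..k} \<in> U}"
  have "istopology (\<lambda>U. U \<subseteq> configs k (topspace X) \<and> openin ?O (?pre U))"
    unfolding istopology_def
  proof (intro conjI allI impI)
    fix S T
    assume S: "S \<subseteq> configs k (topspace X) \<and> openin ?O (?pre S)"
      and T: "T \<subseteq> configs k (topspace X) \<and> openin ?O (?pre T)"
    have "?pre (S \<inter> T) = ?pre S \<inter> ?pre T"
      by blast
    then show "openin ?O (?pre (S \<inter> T))"
      using S T by (metis (no_types, lifting) openin_Int)
  next
    fix \<U>
    assume \<U>: "\<forall>U\<in>\<U>. U \<subseteq> configs k (topspace X) \<and> openin ?O (?pre U)"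
    have "?pre (\<Union>\<U>) = (\<Union>U\<in>\<U>. ?pre U)"
      by blast
    moreover have "openin ?O (\<Union>U\<in>\<U>. ?pre U)"
      using \<U> by (intro openin_Union) auto
    ultimately show "openin ?O (?pre (\<Union>\<U>))"
      by simp
  qed auto
  then show ?thesis
    by (simp add: config_topology_def topology_inverse')
qed

lemma config_image:
  "(\<lambda>x. x ` {1..k}) ` topspace (ordered_config_topology k X) = configs k (topspace X)"
proof (intro equalityI subsetI)
  fix c assume "c \<in> (\<lambda>x. x ` {1..k}) ` topspace (ordered_config_topology k X)"
  then obtain x where "x \<in> {1..k} \<rightarrow>\<^sub>E topspace X" "inj_on x {1..k}" "c = x ` {1..k}"
    by (auto simp: topspace_ordered_config_topology)
  then show "c \<in> configs k (topspace X)"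
    by (auto simp: configs_def card_image)
next
  fix c assume c: "c \<in> configs k (topspace X)"
  then obtain f where "bij_betw f {1..k} c"
    using finite_same_card_bij[of "{1..k}" c] by (auto simp: configs_def)
  then have f: "inj_on f {1..k}" "f ` {1..k} = c"
    by (auto simp: bij_betw_def)
  let ?x = "restrict f {1..k}"
  have im: "?x ` {1..k} = c"
    using f(2) by (simp only: image_restrict_eq)
  have "inj_on ?x {1..k}"
    using f(1) by (simp only: inj_on_restrict_eq)
  moreover have "?x \<in> {1..k} \<rightarrow>\<^sub>E topspace X"
  proof (rule restrict_PiE_iff[THEN iffD2], rule ballI)
    fix i assume "i \<in> {1..k}"
    then have "f i \<in> c"
      using f(2) by blast
    then show "f i \<in> topspace X"
      using c unfolding configs_def by blast
  qed
  ultimately have "?x \<in> topspace (ordered_config_topology k X)"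
    unfolding topspace_ordered_config_topology by blast
  then show "c \<in> (\<lambda>x. x ` {1..k}) ` topspace (ordered_config_topology k X)"
    using im by (metis (no_types, lifting) imageI)
qed

lemma topspace_config_topology: "topspace (config_topology k X) = configs k (topspace X)"
proof
  show "topspace (config_topology k X) \<subseteq> configs k (topspace X)"
    by (metis openin_config_topology openin_topspace)
  have "{x \<in> topspace (ordered_config_topology k X). x ` {1..k} \<in> configs k (topspace X)}
      = topspace (ordered_config_topology k X)"
    using config_image[of k X] by blast
  then have "openin (config_topology k X) (configs k (topspace X))"
    by (simp add: openin_config_topology)
  then show "configs k (topspace X) \<subseteq> topspace (config_topology k X)"
    by (rule openin_subset)
qed

lemma quotient_map_config_topology:
  "quotient_map (ordered_config_topology k X) (config_topology k X) (\<lambda>x. x ` {1..k})"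
  unfolding quotient_map_def
  using config_image[of k X]
  by (auto simp: openin_config_topology topspace_config_topology simp del: One_nat_def)

section \<open>The star\<close>

text \<open>The pair \<open>(i, t)\<close> is the point of the edge from \<open>v\<^sub>0\<close> to \<open>v\<^sub>i\<close> at distance \<open>t\<close>
  from \<open>v\<^sub>0\<close> in the simplicial metric. The central vertex, common to all edges, is represented
  by \<open>(0, 0)\<close> only.\<close>

definition star :: "nat \<Rightarrow> (nat \<times> real) set" where
  "star n = insert (0, 0) ({1..n} \<times> {0<..1})"

definition star_vertex :: "nat \<Rightarrow> nat \<times> real" where
  "star_vertex i = (if i = 0 then (0, 0) else (i, 1))"

text \<open>The absolute values in the second case only make the function nonnegative outside of the
  star.\<close>

definition simplicial_dist :: "nat \<times> real \<Rightarrow> nat \<times> real \<Rightarrow> real" where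
  "simplicial_dist x y =
     (if fst x = fst y then \<bar>snd x - snd y\<bar> else \<bar>snd x\<bar> + \<bar>snd y\<bar>)"

definition star_dist :: "real \<Rightarrow> nat \<times> real \<Rightarrow> nat \<times> real \<Rightarrow> real" where
  "star_dist \<kappa> x y = \<kappa> * simplicial_dist x y"

lemma Metric_space_star:
  assumes "\<kappa> > 0"
  shows "Metric_space (star n) (star_dist \<kappa>)"
proof
  fix x y z assume "x \<in> star n" "y \<in> star n" "z \<in> star n"
  have "simplicial_dist x z \<le> simplicial_dist x y + simplicial_dist y z"
    by (auto simp: simplicial_dist_def)
  then show "star_dist \<kappa> x z \<le> star_dist \<kappa> x y + star_dist \<kappa> y z"
    using assms by (simp add: star_dist_def flip: distrib_left)
next
  fix x y assume "x \<in> star n" "y \<in> star n"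
  then show "star_dist \<kappa> x y = 0 \<longleftrightarrow> x = y"
    using assms
    by (auto simp: star_dist_def simplicial_dist_def star_def prod_eq_iff split: if_splits)
next
  fix x y
  show "star_dist \<kappa> x y = star_dist \<kappa> y x"
    by (auto simp: star_dist_def simplicial_dist_def)
  show "0 \<le> star_dist \<kappa> x y"
    using assms by (auto simp: star_dist_def simplicial_dist_def)
qed

lemma star_dist_vertices:
  assumes "1 \<le> i" "1 \<le> j" "i \<noteq> j"
  shows "star_dist \<kappa> (star_vertex 0) (star_vertex i) = \<kappa>"
    and "star_dist \<kappa> (star_vertex i) (star_vertex j) = 2 * \<kappa>"
  using assms by (auto simp: star_dist_def simplicial_dist_def star_vertex_def)

definition star_topology :: "nat \<Rightarrow> real \<Rightarrow> (nat \<times> real) topology" where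
  "star_topology n \<kappa> = Metric_space.mtopology (star n) (star_dist \<kappa>)"

definition geodesic :: "'a set \<Rightarrow> ('a \<Rightarrow> 'a \<Rightarrow> real) \<Rightarrow> 'a \<Rightarrow> 'a \<Rightarrow> (real \<Rightarrow> 'a) \<Rightarrow> bool" where
  "geodesic M d x y \<gamma> \<longleftrightarrow>
     \<gamma> ` {0..d x y} \<subseteq> M \<and> \<gamma> 0 = x \<and> \<gamma> (d x y) = y \<and>
     (\<forall>s\<in>{0..d x y}. \<forall>t\<in>{0..d x y}. d (\<gamma> s) (\<gamma> t) = \<bar>s - t\<bar>)"

definition geodesic_segment :: "'a set \<Rightarrow> ('a \<Rightarrow> 'a \<Rightarrow> real) \<Rightarrow> 'a \<Rightarrow> 'a \<Rightarrow> 'a set" where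
  "geodesic_segment M d x y = {z. \<exists>\<gamma>. geodesic M d x y \<gamma> \<and> z \<in> \<gamma> ` {0..d x y}}"

abbreviation star_segment :: "nat \<Rightarrow> real \<Rightarrow> nat \<times> real \<Rightarrow> nat \<times> real \<Rightarrow> (nat \<times> real) set" where
  "star_segment n \<kappa> \<equiv> geodesic_segment (star n) (star_dist \<kappa>)"

lemma star_segment_eq:
  assumes "\<kappa> > 0" and x: "x \<in> star n" and y: "y \<in> star n"
  shows "star_segment n \<kappa> x y =
    {z \<in> star n. star_dist \<kappa> x z + star_dist \<kappa> z y = star_dist \<kappa> x y}"
proof (intro equalityI subsetI)
  let ?d = "star_dist \<kappa>"
  fix z assume "z \<in> star_segment n \<kappa> x y"
  then obtain \<gamma> t where \<gamma>: "geodesic (star n) ?d x y \<gamma>"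
    and t: "t \<in> {0..?d x y}" and z: "z = \<gamma> t"
    by (auto simp: geodesic_segment_def)
  have *: "?d (\<gamma> s) (\<gamma> u) = \<bar>s - u\<bar>" if "s \<in> {0..?d x y}" "u \<in> {0..?d x y}" for s u
    using \<gamma> that unfolding geodesic_def by blast
  have "?d (\<gamma> 0) (\<gamma> t) = t" "?d (\<gamma> t) (\<gamma> (?d x y)) = ?d x y - t"
    using *[of 0 t] *[of t "?d x y"] t by auto
  moreover have "z \<in> star n"
    using \<gamma> t z unfolding geodesic_def by blast
  ultimately show "z \<in> {z \<in> star n. ?d x z + ?d z y = ?d x y}"
    using \<gamma> z by (simp add: geodesic_def)
next
  let ?d = "star_dist \<kappa>" and ?r = simplicial_dist
  fix z assume "z \<in> {z \<in> star n. ?d x z + ?d z y = ?d x y}"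
  then have z: "z \<in> star n" and dz: "?d x z + ?d z y = ?d x y"
    by auto
  then have rz: "?r x z + ?r z y = ?r x y"
    using assms(1) unfolding star_dist_def by (metis distrib_left mult_left_cancel less_irrefl)
  have x0: "0 \<le> snd x" and y0: "0 \<le> snd y" and z0: "0 \<le> snd z"
    and x1: "snd x \<le> 1" and y1: "snd y \<le> 1"
    using x y z by (auto simp: star_def)
  have starI: "(i, t) \<in> star n" if "i \<in> {1..n}" "0 < t" "t \<le> 1" for i t
    using that by (auto simp: star_def)
  have xn: "fst x \<in> {1..n} \<and> 0 < snd x \<or> x = (0, 0)" and yn: "fst y \<in> {1..n} \<and> 0 < snd y \<or> y = (0, 0)"
    and zn: "fst z \<in> {1..n} \<and> 0 < snd z \<or> z = (0, 0)"
    using x y z by (auto simp: star_def)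
  define g where "g = (\<lambda>v. if fst x = fst y
      then (fst x, if snd x \<le> snd y then snd x + v else snd x - v)
      else if v < snd x then (fst x, snd x - v)
      else if v = snd x then (0, 0) else (fst y, v - snd x))"
  have g: "g v \<in> star n \<and> g 0 = x \<and> g (?r x y) = y \<and> z = g (?r x z)
      \<and> ?r (g v) (g w) = \<bar>v - w\<bar>"
    if v: "0 \<le> v" "v \<le> ?r x y" and w: "0 \<le> w" "w \<le> ?r x y" for v w
  proof (cases "fst x = fst y")
    case True
    have "g v \<in> star n"
    proof (cases "fst x = 0")
      case True
      then show ?thesis
        using xn yn v \<open>fst x = fst y\<close> by (auto simp: g_def simplicial_dist_def star_def)
    next
      case False
      then have "fst x \<in> {1..n}" "0 < snd x" "0 < snd y"
        using xn yn True by auto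
      then show ?thesis
        using v True x1 y1 by (auto simp: g_def simplicial_dist_def intro!: starI)
    qed
    moreover have "g 0 = x" "g (?r x y) = y"
      using True by (auto simp: g_def simplicial_dist_def prod_eq_iff)
    moreover have "z = g (?r x z)"
    proof (cases "fst z = fst x")
      case zx: True
      show ?thesis
        using True zx rz by (auto simp: g_def simplicial_dist_def prod_eq_iff abs_if split: if_splits)
    next
      case zx: False
      then have "snd x + snd z + (snd z + snd y) = \<bar>snd x - snd y\<bar>"
        using True rz x0 y0 z0 by (simp add: simplicial_dist_def)
      then have "snd z = 0 \<and> (snd x = 0 \<or> snd y = 0)"
        using x0 y0 z0 by arith
      then have "z = x"
        using xn yn zn True zx by auto
      then show ?thesis
        using zx by simp
    qed
    moreover have "?r (g v) (g w) = \<bar>v - w\<bar>"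
      using True by (simp add: g_def simplicial_dist_def abs_minus_commute)
    ultimately show ?thesis
      by blast
  next
    case False
    have rxy: "?r x y = snd x + snd y"
      using False x0 y0 by (simp add: simplicial_dist_def)
    have "g v \<in> star n"
    proof (cases v "snd x" rule: linorder_cases)
      case less
      then have "fst x \<in> {1..n}"
        using xn v by auto
      then show ?thesis
        using less v x1 False by (auto simp: g_def intro!: starI)
    next
      case equal
      then show ?thesis
        using False by (simp add: g_def star_def)
    next
      case greater
      then have "fst y \<in> {1..n}"
        using yn v rxy by auto
      then show ?thesis
        using greater v y1 rxy False by (auto simp: g_def intro!: starI)
    qed
    moreover have "g 0 = x" "g (?r x y) = y"
      using xn yn False by (auto simp: g_def rxy)
    moreover have "z = g (?r x z)"
    proof -
      consider "fst z = fst x" | "fst z \<noteq> fst x" "fst z = fst y" | "fst z \<noteq> fst x" "fst z \<noteq> fst y"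
        by blast
      then show ?thesis
      proof cases
        case 1
        then have "\<bar>snd x - snd z\<bar> + (snd z + snd y) = snd x + snd y"
          using False rz x0 y0 z0 by (simp add: simplicial_dist_def)
        then have "snd z \<le> snd x"
          by arith
        then show ?thesis
          using 1 False zn by (cases z) (auto simp: g_def simplicial_dist_def)
      next
        case 2
        then show ?thesis
          using False x0 z0 zn by (cases z) (auto simp: g_def simplicial_dist_def)
      next
        case 3
        then have "snd x + snd z + (snd z + snd y) = snd x + snd y"
          using False rz x0 y0 z0 by (simp add: simplicial_dist_def)
        then have "snd z = 0"
          by arith
        then have "z = (0, 0)"
          using zn by auto
        then show ?thesis
          using 3 False x0 by (simp add: g_def simplicial_dist_def)
      qed
    qed
    moreover have "?r (g v) (g w) = \<bar>v - w\<bar>"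
    proof -
      have xe: "fst x \<noteq> 0" if "u < snd x" "0 \<le> u" for u
        using xn that by auto
      have ye: "fst y \<noteq> 0" if "snd x < u" "u \<le> snd x + snd y" for u
        using yn that by auto
      have gl: "g u = (fst x, snd x - u)" "fst x \<noteq> 0" if "u < snd x" "0 \<le> u" for u
        using False that xe by (auto simp: g_def)
      have ge: "g (snd x) = (0, 0)"
        using False by (simp add: g_def)
      have gg: "g u = (fst y, u - snd x)" "fst y \<noteq> 0" if "snd x < u" "u \<le> ?r x y" for u
        using False that ye rxy by (auto simp: g_def)
      show ?thesis
        by (cases v "snd x" rule: linorder_cases; cases w "snd x" rule: linorder_cases)
          (use v w False in \<open>simp_all add: gl ge gg simplicial_dist_def\<close>)
    qed
    ultimately show ?thesis
      by blast
  qed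
  define \<gamma> where "\<gamma> u = g (u / \<kappa>)" for u
  have scale: "0 \<le> u / \<kappa> \<and> u / \<kappa> \<le> ?r x y" if "u \<in> {0..?d x y}" for u
    using that assms(1) by (auto simp: star_dist_def field_simps)
  have dk: "?d a b / \<kappa> = ?r a b" for a b
    using assms(1) by (simp add: star_dist_def)
  have r0: "0 \<le> ?r a b" for a b
    by (auto simp: simplicial_dist_def)
  have "\<gamma> ` {0..?d x y} \<subseteq> star n"
    using g[OF _ _ order_refl r0] scale by (auto simp: \<gamma>_def)
  moreover have "\<gamma> 0 = x" "\<gamma> (?d x y) = y" and zg: "z = \<gamma> (?d x z)"
    using g[OF order_refl r0 order_refl r0] by (auto simp: \<gamma>_def dk)
  moreover have "?d (\<gamma> s) (\<gamma> t) = \<bar>s - t\<bar>" if s: "s \<in> {0..?d x y}" and t: "t \<in> {0..?d x y}" for s t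
  proof -
    have "?r (\<gamma> s) (\<gamma> t) = \<bar>s / \<kappa> - t / \<kappa>\<bar>"
      using g[of "s / \<kappa>" "t / \<kappa>"] scale[OF s] scale[OF t] by (simp add: \<gamma>_def)
    also have "\<dots> = \<bar>s - t\<bar> / \<kappa>"
      using assms(1) by (metis abs_div_pos diff_divide_distrib)
    finally show ?thesis
      using assms(1) by (simp add: star_dist_def)
  qed
  ultimately have "geodesic (star n) ?d x y \<gamma>"
    by (auto simp: geodesic_def)
  moreover have "?d x z \<in> {0..?d x y}"
    using dz assms(1) Metric_space.nonneg[OF Metric_space_star[of \<kappa> n]]
    by (metis atLeastAtMost_iff le_add_same_cancel1)
  ultimately show "z \<in> star_segment n \<kappa> x y"
    using zg by (auto simp: geodesic_segment_def)
qed

section \<open>Regular configurations\<close>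

definition star_chain :: "nat \<Rightarrow> real \<Rightarrow> (nat \<times> real) set \<Rightarrow> bool" where
  "star_chain n \<kappa> c \<longleftrightarrow> finite c \<and> c \<subseteq> star n \<and>
     (\<forall>x\<in>c. \<forall>y\<in>c. real (card (c \<inter> star_segment n \<kappa> x y)) = 1 + star_dist \<kappa> x y)"

definition edge_part :: "nat \<Rightarrow> real \<Rightarrow> nat \<Rightarrow> (nat \<times> real) set \<Rightarrow> (nat \<times> real) set" where
  "edge_part n \<kappa> i c = c \<inter> star_segment n \<kappa> (star_vertex 0) (star_vertex i)"

text \<open>Arms are counted as sets. This differs from counting the edges met by \<open>c\<close> when several
  edges meet \<open>c\<close> in the central vertex only, but for configurations of at least two points the
  condition of having at least two arms is the same.\<close>

definition arms :: "nat \<Rightarrow> real \<Rightarrow> (nat \<times> real) set \<Rightarrow> (nat \<times> real) set set" where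
  "arms n \<kappa> c = {edge_part n \<kappa> i c | i. i \<in> {1..n} \<and> edge_part n \<kappa> i c \<noteq> {}}"

definition governing_arm :: "nat \<Rightarrow> real \<Rightarrow> (nat \<times> real) set \<Rightarrow> (nat \<times> real) set \<Rightarrow> bool" where
  "governing_arm n \<kappa> c a \<longleftrightarrow>
     a \<in> arms n \<kappa> c \<and> (\<forall>i\<in>{1..n}. star_chain n \<kappa> (a \<union> edge_part n \<kappa> i c))"

definition regular_config :: "nat \<Rightarrow> real \<Rightarrow> (nat \<times> real) set \<Rightarrow> bool" where
  "regular_config n \<kappa> c \<longleftrightarrow> (\<exists>a. governing_arm n \<kappa> c a) \<and> 2 \<le> card (arms n \<kappa> c)"

definition regular_configs :: "nat \<Rightarrow> nat \<Rightarrow> real \<Rightarrow> (nat \<times> real) set set" where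
  "regular_configs k n \<kappa> = {c \<in> configs k (star n). regular_config n \<kappa> c}"

definition regular_config_space :: "nat \<Rightarrow> nat \<Rightarrow> real \<Rightarrow> (nat \<times> real) set topology" where
  "regular_config_space k n \<kappa> =
     subtopology (config_topology k (star_topology n \<kappa>)) (regular_configs k n \<kappa>)"

end

(* The chain conditions force the points on the governing arm, number m, to lie at distances
   p, p+1, p+2, ... from the center, and those on every other arm at 1-p, 2-p, ..., with
   0 <= p < 1. So a regular configuration is determined by m, by the number of points on each
   edge and by the one real parameter p. The bound on kappa makes all these points fit on the
   edges. For fixed discrete data p runs over a half-open arc. Two such arcs meet only
   at p = 0, where the center belongs to the configuration, and at p = 1/2, where every arm
   governs, except that two arms can exchange roles by p |-> 1-p. Cutting the arcs at
   p = 1/2, 2/3, 3/4, ... gives compact arcs that meet only in endpoints. The family is locally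
   finite: if p tends to 1 on one of the arcs that remain half-open, then two points collide at
   the center. A Hausdorff space with such a decomposition into arcs is a graph. *)

theory Submission
  imports Defs
begin

section \<open>Graphs assembled from arcs\<close>

text \<open>The starts p and 1 - p come from unfolding edges m and i into a line with m on the
  positive side. A chain there is a set of reals with consecutive gaps 1, and the point before the
  first one on edge m, if any, is p - 1, hence at distance 1 - p from the center on edge i. The
  center lies on every edge, so at p = 0 it can be attributed to different arms; only there can the
  numbers of points fail to be determined. The end of an arc other than p = 0 therefore fixes these
  numbers, and both ends together fix the arc, so that no double edges arise. Two topologies have to
  be compared. A map out of the realization is continuous once it is so on each edge. For the
  inverse, arcs are compact in a Hausdorff space, hence closed and embedded, and local finiteness
  permits pasting along them. The configuration space is a quotient, where open sets are awkward to
  exhibit. But the sum of a continuous function over the points of a configuration is continuous,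
  and tents around one point suffice both to separate configurations and to find neighborhoods that
  meet finitely many arcs.\<close>

lemma topspace_realization: "topspace (realization K) = (\<Union>\<sigma>\<in>K. closed_simplex \<sigma>)"
proof
  show "topspace (realization K) \<subseteq> (\<Union>\<sigma>\<in>K. closed_simplex \<sigma>)"
    using openin_realization[of K "topspace (realization K)"] by simp
  have "openin (realization K) (\<Union>\<sigma>\<in>K. closed_simplex \<sigma>)"
    unfolding openin_realization by (auto simp: Int_absorb1 SUP_upper)
  then show "(\<Union>\<sigma>\<in>K. closed_simplex \<sigma>) \<subseteq> topspace (realization K)"
    by (rule openin_subset)
qed

text \<open>The weak topology tests continuity on closed simplices, and a face inherits it from any
  simplex containing it. Passing to a larger \<open>\<tau>\<close> leaves only the edges of a graph
  to be checked.\<close>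

lemma continuous_map_from_realization:
  assumes "\<And>\<sigma>. \<sigma> \<in> K \<Longrightarrow> \<exists>\<tau>\<in>K. \<sigma> \<subseteq> \<tau> \<and> closed_simplex \<sigma> \<subseteq> closed_simplex \<tau>
      \<and> continuous_map (top_of_set (closed_simplex \<tau>)) X G"
  shows "continuous_map (realization K) X G"
proof -
  have c: "continuous_map (top_of_set (closed_simplex \<sigma>)) X G" if "\<sigma> \<in> K" for \<sigma>
  proof -
    obtain \<tau> where "closed_simplex \<sigma> \<subseteq> closed_simplex \<tau>"
      "continuous_map (top_of_set (closed_simplex \<tau>)) X G"
      using assms[OF \<open>\<sigma> \<in> K\<close>] by blast
    then show ?thesis
      using continuous_map_from_subtopology_mono by blast
  qed
  have "openin (realization K) {x \<in> topspace (realization K). G x \<in> U}" if U: "openin X U" for U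
    unfolding openin_realization
  proof (intro conjI ballI)
    fix \<sigma> assume s: "\<sigma> \<in> K"
    have "{x \<in> topspace (realization K). G x \<in> U} \<inter> closed_simplex \<sigma>
        = {x \<in> topspace (top_of_set (closed_simplex \<sigma>)). G x \<in> U}"
      using s by (auto simp: topspace_realization)
    then show "openin (top_of_set (closed_simplex \<sigma>))
        ({x \<in> topspace (realization K). G x \<in> U} \<inter> closed_simplex \<sigma>)"
      using openin_continuous_map_preimage[OF c[OF s] U] by simp
  qed (auto simp: topspace_realization)
  moreover have "G ` topspace (realization K) \<subseteq> topspace X"
    using c by (fastforce simp: topspace_realization continuous_map_def)
  ultimately show ?thesis
    by (auto simp: continuous_map_def)
qed

lemma continuous_map_into_realization:
  assumes "\<sigma> \<in> K" "continuous_map Y (top_of_set (closed_simplex \<sigma>)) h"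
  shows "continuous_map Y (realization K) h"
proof -
  have im: "h x \<in> closed_simplex \<sigma>" if "x \<in> topspace Y" for x
    using assms(2) that by (auto simp: continuous_map_def)
  have "openin Y {x \<in> topspace Y. h x \<in> U}" if "openin (realization K) U" for U
  proof -
    have "openin (top_of_set (closed_simplex \<sigma>)) (U \<inter> closed_simplex \<sigma>)"
      using that assms(1) by (simp add: openin_realization)
    from openin_continuous_map_preimage[OF assms(2) this]
    have "openin Y {x \<in> topspace Y. h x \<in> U \<inter> closed_simplex \<sigma>}" .
    moreover have "{x \<in> topspace Y. h x \<in> U \<inter> closed_simplex \<sigma>} = {x \<in> topspace Y. h x \<in> U}"
      using im by auto
    ultimately show ?thesis by simp
  qed
  then show ?thesis
    using im assms(1) by (auto simp: continuous_map_def topspace_realization)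
qed

definition edge_point :: "'v \<Rightarrow> 'v \<Rightarrow> real \<Rightarrow> 'v \<Rightarrow> real" where
  "edge_point u w t = (\<lambda>v. if v = w then t else if v = u then 1 - t else 0)"

lemma closed_simplex_edge:
  assumes "u \<noteq> w"
  shows "x \<in> closed_simplex {u, w} \<longleftrightarrow> x w \<in> {0..1} \<and> x = edge_point u w (x w)"
proof
  assume x: "x \<in> closed_simplex {u, w}"
  then have "x u + x w = 1" and n: "\<And>v. 0 \<le> x v" and z: "\<And>v. v \<noteq> u \<Longrightarrow> v \<noteq> w \<Longrightarrow> x v = 0"
    using assms by (auto simp: closed_simplex_def)
  then have "x u = 1 - x w" by simp
  moreover have "x w \<le> 1"
    using n[of u] \<open>x u + x w = 1\<close> by simp
  ultimately show "x w \<in> {0..1} \<and> x = edge_point u w (x w)"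
    using z n by (auto simp: edge_point_def fun_eq_iff)
next
  assume "x w \<in> {0..1} \<and> x = edge_point u w (x w)"
  then obtain t where "t \<in> {0..1}" "x = edge_point u w t" by blast
  then show "x \<in> closed_simplex {u, w}"
    using assms by (auto simp: closed_simplex_def edge_point_def)
qed

lemma continuous_map_edge_point:
  assumes "u \<noteq> w"
  shows "continuous_map (top_of_set {0..1}) (top_of_set (closed_simplex {u, w})) (edge_point u w)"
proof -
  have "continuous_on {0..1} (\<lambda>t. edge_point u w t v)" for v
    unfolding edge_point_def by (cases "v = w"; cases "v = u") (auto intro!: continuous_intros)
  then have "continuous_on {0..1} (edge_point u w)"
    by (rule continuous_on_coordinatewise_then_product)
  moreover have "edge_point u w t \<in> closed_simplex {u, w}" if "t \<in> {0..1}" for t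
    using that assms by (auto simp: closed_simplex_edge) (auto simp: edge_point_def)
  ultimately show ?thesis
    by (auto simp: continuous_map_in_subtopology)
qed

text \<open>The hypothesis on pairs of ends excludes multiple edges, so that the ends and
  the arcs are the vertices and the edges of a simplicial complex.\<close>

lemma graph_of_arcs:
  fixes X :: "'a topology" and \<gamma> :: "'i \<Rightarrow> real \<Rightarrow> 'a"
  assumes haus: "Hausdorff_space X"
    and I: "countable I"
    and cont: "\<And>i. i \<in> I \<Longrightarrow> continuous_map (top_of_set {0..1}) X (\<gamma> i)"
    and cover: "topspace X = (\<Union>i\<in>I. \<gamma> i ` {0..1})"
    and lf: "\<And>x. x \<in> topspace X \<Longrightarrow>
      \<exists>U. openin X U \<and> x \<in> U \<and> finite {i \<in> I. \<gamma> i ` {0..1} \<inter> U \<noteq> {}}"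
    and meet: "\<And>i j s t. \<lbrakk>i \<in> I; j \<in> I; s \<in> {0..1}; t \<in> {0..1}; \<gamma> i s = \<gamma> j t\<rbrakk> \<Longrightarrow>
      i = j \<and> s = t \<or> s \<in> {0, 1} \<and> t \<in> {0, 1}"
    and loop: "\<And>i. i \<in> I \<Longrightarrow> \<gamma> i 0 \<noteq> \<gamma> i 1"
    and simple: "\<And>i j. \<lbrakk>i \<in> I; j \<in> I; {\<gamma> i 0, \<gamma> i 1} = {\<gamma> j 0, \<gamma> j 1}\<rbrakk> \<Longrightarrow> i = j"
  shows "topological_graph X \<and> (I \<noteq> {} \<longrightarrow> polyhedron_of_dim 1 X)"
proof -
  define V where "V = (\<Union>i\<in>I. {\<gamma> i 0, \<gamma> i 1})"
  have "countable V"
    unfolding V_def using I by (intro countable_UN) auto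
  \<comment> \<open>Complexes have natural numbers as vertices, so the countably many ends are
    numbered.\<close>
  then obtain enc :: "'a \<Rightarrow> nat" where enc: "inj_on enc V"
    by (auto simp: countable_def)
  have VI: "\<gamma> i t \<in> V" if "i \<in> I" "t \<in> {0, 1}" for i t
    using that by (auto simp: V_def)
  define u where "u i = enc (\<gamma> i 0)" for i
  define w where "w i = enc (\<gamma> i 1)" for i
  define K where "K = {\<sigma>. \<sigma> \<noteq> {} \<and> (\<exists>i\<in>I. \<sigma> \<subseteq> {u i, w i})}"
  define h where "h i = edge_point (u i) (w i)" for i
  have uw: "u i \<noteq> w i" if "i \<in> I" for i
    using loop[OF that] inj_onD[OF enc] VI[OF that] by (auto simp: u_def w_def)
  have complex: "abstract_complex K"
    unfolding abstract_complex_def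
  proof (intro ballI conjI allI impI)
    fix \<sigma> assume "\<sigma> \<in> K"
    then obtain i where i: "i \<in> I" "\<sigma> \<subseteq> {u i, w i}" "\<sigma> \<noteq> {}"
      by (auto simp: K_def)
    then show "finite \<sigma>" "\<sigma> \<noteq> {}"
      by (auto intro: finite_subset)
    fix \<tau> assume "\<tau> \<noteq> {} \<and> \<tau> \<subseteq> \<sigma>"
    then show "\<tau> \<in> K"
      using i unfolding K_def by blast
  qed
  have edge: "{u i, w i} \<in> K" if "i \<in> I" for i
    using that by (auto simp: K_def)
  have sub: "closed_simplex \<sigma> \<subseteq> closed_simplex \<tau>" if "\<sigma> \<subseteq> \<tau>" "finite \<tau>" for \<sigma> \<tau> :: "nat set"
  proof
    fix x assume x: "x \<in> closed_simplex \<sigma>"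
    then have "sum x \<tau> = sum x \<sigma>"
      using that by (intro sum.mono_neutral_right) (auto simp: closed_simplex_def)
    then show "x \<in> closed_simplex \<tau>"
      using x that by (auto simp: closed_simplex_def)
  qed
  have hS: "h i t \<in> closed_simplex {u i, w i}" if "i \<in> I" "t \<in> {0..1}" for i t
    using that uw[OF that(1)] by (auto simp: h_def closed_simplex_edge) (auto simp: edge_point_def)
  have hw: "h i t (w i) = t" and hu: "i \<in> I \<Longrightarrow> h i t (u i) = 1 - t" for i t
    using uw[of i] by (auto simp: h_def edge_point_def)
  have h0: "h i t v \<noteq> 0 \<Longrightarrow> v \<in> {u i, w i}" for i t v
    by (auto simp: h_def edge_point_def split: if_splits)
  have hend: "h i t = (\<lambda>v. if v = enc (\<gamma> i t) then 1 else 0)" if "i \<in> I" "t \<in> {0, 1}" for i t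
    using that uw[OF that(1)] by (auto simp: h_def edge_point_def u_def w_def fun_eq_iff)
  \<comment> \<open>This makes the correspondence between \<open>\<gamma> i t\<close> and
    \<open>h i t\<close> well defined in both directions, so that \<open>F\<close> and
    \<open>G\<close> below do not depend on the choices made.\<close>
  have h_eq: "h i s = h j t \<longleftrightarrow> \<gamma> i s = \<gamma> j t"
    if ij: "i \<in> I" "j \<in> I" and st: "s \<in> {0..1}" "t \<in> {0..1}" for i j s t
  proof
    assume "\<gamma> i s = \<gamma> j t"
    then consider "i = j \<and> s = t" | "s \<in> {0, 1}" "t \<in> {0, 1}"
      using meet[OF ij st] by blast
    then show "h i s = h j t"
      by cases (auto simp: hend[OF ij(1)] hend[OF ij(2)] \<open>\<gamma> i s = \<gamma> j t\<close>)
  next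
    assume eq: "h i s = h j t"
    \<comment> \<open>A point with coordinates 0 and 1 is a vertex, so an end can only coincide with
      an end.\<close>
    have aux: "t \<in> {0, 1} \<and> \<gamma> i s = \<gamma> j t" if ij: "i \<in> I" "j \<in> I" and s: "s \<in> {0, 1}"
      and t: "t \<in> {0..1}" and eq: "h i s = h j t" for i j s t
    proof -
      have "h j t (w j) \<in> {0, 1}"
        using hend[OF ij(1) s] eq by (metis insertCI)
      then have t: "t \<in> {0, 1}"
        by (simp add: hw)
      then have "(\<lambda>v. if v = enc (\<gamma> i s) then 1 else 0 :: real) =
          (\<lambda>v. if v = enc (\<gamma> j t) then 1 else 0)"
        using hend[OF ij(1) s] hend[OF ij(2) t] eq by simp
      then have "enc (\<gamma> i s) = enc (\<gamma> j t)"
        by (metis zero_neq_one)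
      then show ?thesis
        using inj_onD[OF enc] VI[OF ij(1) s] VI[OF ij(2) t] t by blast
    qed
    show "\<gamma> i s = \<gamma> j t"
    proof (cases "s \<in> {0, 1} \<or> t \<in> {0, 1}")
      case True
      then show ?thesis
        using aux[OF ij _ st(2) eq] aux[OF ij(2,1) _ st(1) eq[symmetric]] by metis
    next
      case False
      \<comment> \<open>Away from the ends both coordinates are nonzero, so the point determines the
        vertices of its edge, and \<open>simple\<close> then determines the edge.\<close>
      then have "h i s (u i) \<noteq> 0" "h i s (w i) \<noteq> 0" "h j t (u j) \<noteq> 0" "h j t (w j) \<noteq> 0"
        using ij st by (auto simp: hw hu)
      then have "{u i, w i} = {u j, w j}"
        using h0 eq uw[OF ij(1)] uw[OF ij(2)] by (metis (no_types, lifting) insert_commute insertE singletonD)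
      then have "enc ` {\<gamma> i 0, \<gamma> i 1} = enc ` {\<gamma> j 0, \<gamma> j 1}"
        by (simp add: u_def w_def)
      moreover have "{\<gamma> i 0, \<gamma> i 1} \<subseteq> V" "{\<gamma> j 0, \<gamma> j 1} \<subseteq> V"
        using ij by (auto simp: V_def)
      ultimately have "{\<gamma> i 0, \<gamma> i 1} = {\<gamma> j 0, \<gamma> j 1}"
        using inj_on_image_eq_iff[OF enc] by blast
      then have "i = j"
        using simple ij by blast
      then show ?thesis
        using eq hw by metis
    qed
  qed
  define F where "F x = (SOME y. \<exists>i\<in>I. \<exists>t\<in>{0..1}. x = \<gamma> i t \<and> y = h i t)" for x
  have F: "F (\<gamma> i t) = h i t" if "i \<in> I" "t \<in> {0..1}" for i t
    unfolding F_def by (rule some_equality) (use that h_eq in metis)+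
  define G where "G y = (SOME x. \<exists>i\<in>I. \<exists>t\<in>{0..1}. x = \<gamma> i t \<and> y = h i t)" for y
  have G: "G (h i t) = \<gamma> i t" if "i \<in> I" "t \<in> {0..1}" for i t
    unfolding G_def by (rule some_equality) (use that h_eq in metis)+
  have topK: "topspace (realization K) = (\<Union>i\<in>I. h i ` {0..1})"
  proof -
    have "(\<Union>\<sigma>\<in>K. closed_simplex \<sigma>) = (\<Union>i\<in>I. closed_simplex {u i, w i})"
    proof
      show "(\<Union>\<sigma>\<in>K. closed_simplex \<sigma>) \<subseteq> (\<Union>i\<in>I. closed_simplex {u i, w i})"
      proof
        fix x assume "x \<in> (\<Union>\<sigma>\<in>K. closed_simplex \<sigma>)"
        then obtain \<sigma> i where "i \<in> I" "\<sigma> \<subseteq> {u i, w i}" "x \<in> closed_simplex \<sigma>"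
          by (auto simp: K_def)
        then show "x \<in> (\<Union>i\<in>I. closed_simplex {u i, w i})"
          using sub[of \<sigma> "{u i, w i}"] by auto
      qed
    qed (use edge in auto)
    also have "\<dots> = (\<Union>i\<in>I. h i ` {0..1})"
    proof (rule SUP_cong[OF refl])
      fix i assume i: "i \<in> I"
      show "closed_simplex {u i, w i} = h i ` {0..1}"
        using hS[OF i] closed_simplex_edge[OF uw[OF i]] by (auto simp: h_def)
    qed
    finally show ?thesis
      by (simp add: topspace_realization)
  qed
  have "continuous_map (realization K) X G"
  proof (rule continuous_map_from_realization)
    fix \<sigma> assume "\<sigma> \<in> K"
    then obtain i where i: "i \<in> I" "\<sigma> \<subseteq> {u i, w i}"
      by (auto simp: K_def)
    have w: "continuous_map (top_of_set (closed_simplex {u i, w i})) (top_of_set {0..1}) (\<lambda>y. y (w i))"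
      using closed_simplex_edge[OF uw[OF i(1)]]
      by (auto simp: continuous_map_in_subtopology intro!: continuous_on_product_coordinates
          continuous_on_subset[of UNIV])
    have "continuous_map (top_of_set (closed_simplex {u i, w i})) X (\<gamma> i \<circ> (\<lambda>y. y (w i)))"
      by (rule continuous_map_compose[OF w cont[OF i(1)]])
    then have "continuous_map (top_of_set (closed_simplex {u i, w i})) X G"
    proof (rule continuous_map_eq)
      fix y assume "y \<in> topspace (top_of_set (closed_simplex {u i, w i}))"
      then have "y (w i) \<in> {0..1}" "y = h i (y (w i))"
        using closed_simplex_edge[OF uw[OF i(1)]] by (auto simp: h_def)
      then show "(\<gamma> i \<circ> (\<lambda>y. y (w i))) y = G y"
        using G[OF i(1), of "y (w i)"] by simp
    qed
    then show "\<exists>\<tau>\<in>K. \<sigma> \<subseteq> \<tau> \<and> closed_simplex \<sigma> \<subseteq> closed_simplex \<tau>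
        \<and> continuous_map (top_of_set (closed_simplex \<tau>)) X G"
      using edge[OF i(1)] i(2) sub[of \<sigma> "{u i, w i}"] by blast
  qed
  \<comment> \<open>The arcs form a locally finite closed cover: they are compact in a Hausdorff
    space, so they are closed and each \<open>\<gamma> i\<close> is an embedding. On arc
    \<open>i\<close> the map \<open>F\<close> is the inverse of \<open>\<gamma> i\<close> followed
    by \<open>h i\<close>.\<close>
  moreover have "continuous_map X (realization K) F"
  proof (rule pasting_lemma_locally_finite[where I = I and T = "\<lambda>i. \<gamma> i ` {0..1}" and f = "\<lambda>_. F"])
    fix i assume i: "i \<in> I"
    have inj: "inj_on (\<gamma> i) {0..1}"
    proof (rule inj_onI)
      fix s t :: real assume "s \<in> {0..1}" "t \<in> {0..1}" "\<gamma> i s = \<gamma> i t"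
      then show "s = t"
        using h_eq[OF i i] hw by metis
    qed
    have "compactin X (\<gamma> i ` {0..1})"
      by (rule image_compactin[OF _ cont[OF i]]) (simp add: compactin_subtopology)
    then show "closedin X (\<gamma> i ` {0..1})"
      by (rule compactin_imp_closedin[OF haus])
    have "embedding_map (top_of_set {0..1}) X (\<gamma> i)"
      using inj by (intro continuous_imp_embedding_map cont[OF i] haus)
        (auto simp: compact_space_subtopology)
    then obtain g where "homeomorphic_maps (top_of_set {0..1}) (subtopology X (\<gamma> i ` {0..1})) (\<gamma> i) g"
      by (auto simp: embedding_map_def homeomorphic_map_maps)
    then have g: "continuous_map (subtopology X (\<gamma> i ` {0..1})) (top_of_set {0..1}) g"
      and gg: "\<And>t. t \<in> {0..1} \<Longrightarrow> g (\<gamma> i t) = t"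
      by (auto simp: homeomorphic_maps_def)
    have "continuous_map (top_of_set {0..1}) (realization K) (h i)"
      unfolding h_def
      by (rule continuous_map_into_realization[OF edge[OF i] continuous_map_edge_point[OF uw[OF i]]])
    from continuous_map_compose[OF g this]
    show "continuous_map (subtopology X (\<gamma> i ` {0..1})) (realization K) F"
      by (rule continuous_map_eq) (auto simp: gg F[OF i])
  qed (use lf cover in auto)
  ultimately have "homeomorphic_maps X (realization K) F G"
    by (auto simp: homeomorphic_maps_def cover topK F G)
  then have homeo: "X homeomorphic_space realization K"
    unfolding homeomorphic_space_def by blast
  have card: "\<forall>\<sigma>\<in>K. card \<sigma> \<le> 1 + 1"
  proof
    fix \<sigma> assume "\<sigma> \<in> K"
    then obtain i where i: "\<sigma> \<subseteq> {u i, w i}"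
      by (auto simp: K_def)
    have "card \<sigma> \<le> card {u i, w i}"
      by (rule card_mono[OF _ i]) simp
    also have "\<dots> \<le> 1 + 1"
      by (simp add: card_insert_if)
    finally show "card \<sigma> \<le> 1 + 1" .
  qed
  moreover have "\<exists>\<sigma>\<in>K. card \<sigma> = 1 + 1" if "I \<noteq> {}"
  proof -
    obtain i where "i \<in> I" using \<open>I \<noteq> {}\<close> by blast
    then show ?thesis
      using edge uw by (intro bexI[of _ "{u i, w i}"]) auto
  qed
  ultimately show ?thesis
    unfolding polyhedron_of_dim_le_def polyhedron_of_dim_def
    using complex homeo by blast
qed

section \<open>Topology of configuration spaces\<close>

text \<open>Numbering the index set lifts the family to ordered configurations, and the quotient map
  takes it down again. Injectivity keeps the lift off the fat diagonal.\<close>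

lemma continuous_map_into_config:
  assumes J: "finite J" "card J = k"
    and f: "\<And>j. j \<in> J \<Longrightarrow> continuous_map Y X (f j)"
    and inj: "\<And>y. y \<in> topspace Y \<Longrightarrow> inj_on (\<lambda>j. f j y) J"
  shows "continuous_map Y (config_topology k X) (\<lambda>y. (\<lambda>j. f j y) ` J)"
proof -
  obtain e where "bij_betw e {1..k} J"
    using finite_same_card_bij[of "{1..k}" J] J by auto
  then have e: "inj_on e {1..k}" "e ` {1..k} = J"
    by (auto simp: bij_betw_def)
  define g where "g y = (\<lambda>i\<in>{1..k}. f (e i) y)" for y
  have fe: "continuous_map Y X (f (e i))" if "i \<in> {1..k}" for i
    using f e(2) that by blast
  have "g y \<in> {1..k} \<rightarrow>\<^sub>E topspace X" if "y \<in> topspace Y" for y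
    unfolding g_def restrict_PiE_iff
  proof
    fix i assume "i \<in> {1..k}"
    from continuous_map_funspace[OF fe[OF this]] that show "f (e i) y \<in> topspace X"
      by (rule funcset_mem)
  qed
  moreover have "inj_on (g y) {1..k}" if "y \<in> topspace Y" for y
  proof -
    have "inj_on ((\<lambda>j. f j y) \<circ> e) {1..k}"
      using e inj[OF that] by (simp add: comp_inj_on)
    then show ?thesis
      unfolding g_def inj_on_restrict_eq by (simp only: comp_def)
  qed
  ultimately have "g \<in> topspace Y \<rightarrow> ({1..k} \<rightarrow>\<^sub>E topspace X) - fat_diagonal k (topspace X)"
    unfolding fat_diagonal_def inj_on_def by blast
  moreover have "continuous_map Y (product_topology (\<lambda>_. X) {1..k}) g"
    unfolding continuous_map_componentwise
  proof (intro conjI ballI)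
    show "g ` topspace Y \<subseteq> extensional {1..k}"
      unfolding g_def by (simp only: image_subset_iff restrict_extensional ball_triv simp_thms)
    fix i assume i: "i \<in> {1..k}"
    show "continuous_map Y X (\<lambda>x. g x i)"
      unfolding g_def restrict_apply'[OF i] using fe[OF i] .
  qed
  ultimately have "continuous_map Y (ordered_config_topology k X) g"
    unfolding ordered_config_topology_def continuous_map_in_subtopology by blast
  then have "continuous_map Y (config_topology k X) ((\<lambda>x. x ` {1..k}) \<circ> g)"
    using quotient_imp_continuous_map[OF quotient_map_config_topology] by (rule continuous_map_compose)
  moreover have "((\<lambda>x. x ` {1..k}) \<circ> g) y = (\<lambda>j. f j y) ` J" for y
    unfolding e(2)[symmetric] by (simp add: g_def image_image)
  ultimately show ?thesis
    by (simp add: comp_def)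
qed

text \<open>A sum is invariant under renumbering, so it descends to the quotient. Preimages under
  such sums are the open sets used for separation and for local finiteness.\<close>

lemma continuous_map_config_sum:
  assumes g: "continuous_map X euclideanreal g"
  shows "continuous_map (config_topology k X) euclideanreal (sum g)"
proof (rule continuous_compose_quotient_map[OF quotient_map_config_topology])
  have "continuous_map (ordered_config_topology k X) euclideanreal (\<lambda>x. \<Sum>i\<in>{1..k}. (g \<circ> (\<lambda>x. x i)) x)"
  proof (rule continuous_map_sum)
    fix i assume i: "i \<in> {1..k}"
    have "continuous_map (ordered_config_topology k X) X (\<lambda>x. x i)"
      unfolding ordered_config_topology_def
      by (rule continuous_map_from_subtopology[OF continuous_map_product_projection[OF i]])
    then show "continuous_map (ordered_config_topology k X) euclideanreal (\<lambda>x. (g \<circ> (\<lambda>x. x i)) x)"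
      by (rule continuous_map_compose[OF _ g])
  qed simp
  then show "continuous_map (ordered_config_topology k X) euclideanreal (sum g \<circ> (\<lambda>x. x ` {1..k}))"
  proof (rule continuous_map_eq)
    fix x assume "x \<in> topspace (ordered_config_topology k X)"
    then have "inj_on x {1..k}"
      by (simp add: topspace_ordered_config_topology)
    then show "(\<Sum>i\<in>{1..k}. (g \<circ> (\<lambda>x. x i)) x) = (sum g \<circ> (\<lambda>x. x ` {1..k})) x"
      by (simp add: sum.reindex)
  qed
qed

context Metric_space
begin

definition bump :: "'a \<Rightarrow> real \<Rightarrow> 'a \<Rightarrow> real" where
  "bump x r y = max 0 (r - d x y)"

lemma bump_nonneg: "0 \<le> bump x r y"
  by (simp add: bump_def)

lemma continuous_map_config_bump:
  assumes "x \<in> M"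
  shows "continuous_map (config_topology k mtopology) euclideanreal (sum (bump x r))"
proof -
  have "continuous_map mtopology euclideanreal (\<lambda>y. mdist (metric (M, d)) x y)"
    using assms by (intro continuous_map_mdist) (auto simp: mtopology_of_def mspace_metric mdist_metric)
  then have "continuous_map mtopology euclideanreal (d x)"
    by (simp add: mdist_metric)
  then have "continuous_map mtopology euclideanreal (bump x r)"
    unfolding bump_def [abs_def]
    by (intro continuous_map_real_max continuous_map_diff) auto
  then show ?thesis
    by (rule continuous_map_config_sum)
qed

lemma Hausdorff_space_config: "Hausdorff_space (config_topology k mtopology)"
  unfolding Hausdorff_space_def
proof (intro allI impI)
  fix c c' assume "c \<in> topspace (config_topology k mtopology)
    \<and> c' \<in> topspace (config_topology k mtopology) \<and> c \<noteq> c'"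
  then have c: "c \<subseteq> M" "finite c" "c' \<subseteq> M" "finite c'" "card c = card c'" "c \<noteq> c'"
    and top: "c \<in> topspace (config_topology k mtopology)" "c' \<in> topspace (config_topology k mtopology)"
    by (auto simp: topspace_config_topology configs_def)
  then have "\<not> c \<subseteq> c'"
    by (metis card_subset_eq)
  then obtain x where x: "x \<in> c" "x \<notin> c'" by blast
  \<comment> \<open>As \<open>r\<close> is at most the distance from \<open>x\<close> to any point
    of \<open>c'\<close>, the bumps vanish on \<open>c'\<close> but sum to at least \<open>r\<close>
    on \<open>c\<close>. The \<open>1\<close> makes the minimum one over a nonempty set.\<close>
  define r where "r = Min (insert 1 (d x ` c'))"
  have pos: "0 < d x y" if "y \<in> c'" for y
    using that x c by (intro mdist_pos_less) auto
  then have r: "0 < r"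
    using c by (simp add: r_def)
  have "r \<le> d x y" if "y \<in> c'" for y
    using that c by (simp add: r_def)
  then have 0: "sum (bump x r) c' = 0"
    by (intro sum.neutral) (auto simp: bump_def)
  have "bump x r x \<le> sum (bump x r) c"
    using c x by (intro member_le_sum) (auto simp: bump_nonneg)
  then have 1: "r \<le> sum (bump x r) c"
    using r x c by (simp add: bump_def subset_iff)
  let ?X = "config_topology k mtopology"
  have xM: "x \<in> M" using x c by auto
  note op = openin_continuous_map_preimage[OF continuous_map_config_bump[OF xM]]
  have "openin ?X {c \<in> topspace ?X. sum (bump x r) c \<in> {r/2<..}}"
    "openin ?X {c \<in> topspace ?X. sum (bump x r) c \<in> {..<r/2}}"
    by (rule op; simp)+
  moreover have "disjnt {c \<in> topspace ?X. sum (bump x r) c \<in> {r/2<..}} {c \<in> topspace ?X. sum (bump x r) c \<in> {..<r/2}}"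
    by (auto simp: disjnt_def)
  ultimately show "\<exists>U V. openin ?X U \<and> openin ?X V \<and> c \<in> U \<and> c' \<in> V \<and> disjnt U V"
    using 0 1 r top
    by (intro exI[of _ "{c \<in> topspace ?X. sum (bump x r) c \<in> {r/2<..}}"]
        exI[of _ "{c \<in> topspace ?X. sum (bump x r) c \<in> {..<r/2}}"]) auto
qed

end

section \<open>Chains in the star\<close>

text \<open>\<open>s\<close> is the distance to the center in the scaled metric, in which neighbors
  in a chain are 1 apart. All edges share the point with \<open>s = 0\<close>.\<close>

definition star_point :: "real \<Rightarrow> nat \<Rightarrow> real \<Rightarrow> nat \<times> real" where
  "star_point \<kappa> i s = (if s = 0 then (0, 0) else (i, s / \<kappa>))"

lemma star_point_in_star:
  assumes "\<kappa> > 0" "i \<in> {1..n}" "s \<in> {0..\<kappa>}"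
  shows "star_point \<kappa> i s \<in> star n"
  using assms by (auto simp: star_point_def star_def)

lemma in_star_cases:
  assumes "\<kappa> > 0" "n \<ge> 1" "x \<in> star n"
  obtains i s where "i \<in> {1..n}" "s \<in> {0..\<kappa>}" "x = star_point \<kappa> i s"
proof (cases "x = (0, 0)")
  case True
  then show ?thesis
    using assms that[of 1 0] by (auto simp: star_point_def)
next
  case False
  then show ?thesis
    using assms that[of "fst x" "\<kappa> * snd x"] by (auto simp: star_point_def star_def)
qed

lemma star_point_eq_iff:
  assumes "\<kappa> > 0" "i \<ge> 1" "j \<ge> 1"
  shows "star_point \<kappa> i s = star_point \<kappa> j t \<longleftrightarrow> s = t \<and> (s = 0 \<or> i = j)"
  using assms by (auto simp: star_point_def)

lemma star_dist_star_point:
  assumes "\<kappa> > 0" "i \<ge> 1" "j \<ge> 1" "s \<ge> 0" "t \<ge> 0"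
  shows "star_dist \<kappa> (star_point \<kappa> i s) (star_point \<kappa> j t) = (if i = j then \<bar>s - t\<bar> else s + t)"
proof -
  have "\<kappa> * \<bar>s / \<kappa> - t / \<kappa>\<bar> = \<bar>s - t\<bar>"
    using assms(1) by (simp add: abs_mult_pos' right_diff_distrib)
  then show ?thesis
    using assms by (auto simp: star_dist_def simplicial_dist_def star_point_def distrib_left)
qed

text \<open>The edges \<open>m\<close> and \<open>i\<close> form a segment, with \<open>v\<^sub>m\<close> at \<open>\<kappa>\<close> and \<open>v\<^sub>i\<close> at \<open>-\<kappa>\<close>.\<close>

definition star_line :: "real \<Rightarrow> nat \<Rightarrow> nat \<Rightarrow> real \<Rightarrow> nat \<times> real" where
  "star_line \<kappa> m i x = (if x \<ge> 0 then star_point \<kappa> m x else star_point \<kappa> i (- x))"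

lemma star_line_in_star:
  assumes "\<kappa> > 0" "m \<in> {1..n}" "i \<in> {1..n}" "x \<in> {-\<kappa>..\<kappa>}"
  shows "star_line \<kappa> m i x \<in> star n"
  using assms by (auto simp: star_line_def intro!: star_point_in_star)

lemma star_dist_star_line:
  assumes "\<kappa> > 0" "m \<ge> 1" "i \<ge> 1" "m \<noteq> i"
  shows "star_dist \<kappa> (star_line \<kappa> m i x) (star_line \<kappa> m i y) = \<bar>x - y\<bar>"
  using assms by (auto simp: star_line_def star_dist_star_point)

lemma inj_star_line:
  assumes "\<kappa> > 0" "m \<ge> 1" "i \<ge> 1" "m \<noteq> i"
  shows "inj (star_line \<kappa> m i)"
  using assms by (auto simp: star_line_def inj_on_def star_point_eq_iff split: if_splits)

lemma star_segment_star_line: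
  assumes "\<kappa> > 0" and mi: "m \<in> {1..n}" "i \<in> {1..n}" "m \<noteq> i"
    and xy: "x \<in> {-\<kappa>..\<kappa>}" "y \<in> {-\<kappa>..\<kappa>}" "x \<le> y"
  shows "star_segment n \<kappa> (star_line \<kappa> m i x) (star_line \<kappa> m i y) = star_line \<kappa> m i ` {x..y}"
proof -
  let ?L = "star_line \<kappa> m i" and ?d = "star_dist \<kappa>"
  have d: "?d (?L s) (?L t) = \<bar>s - t\<bar>" for s t
    using assms by (intro star_dist_star_line) auto
  have L: "?L t \<in> star n" if "t \<in> {-\<kappa>..\<kappa>}" for t
    using assms that by (intro star_line_in_star)
  show ?thesis
    unfolding star_segment_eq[OF assms(1) L[OF xy(1)] L[OF xy(2)]]
  proof (intro equalityI subsetI)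
    fix z assume "z \<in> {z \<in> star n. ?d (?L x) z + ?d z (?L y) = ?d (?L x) (?L y)}"
    then have z: "z \<in> star n" "?d (?L x) z + ?d z (?L y) = ?d (?L x) (?L y)" by auto
    obtain j s where j: "j \<in> {1..n}" "s \<in> {0..\<kappa>}" "z = star_point \<kappa> j s"
      using in_star_cases[OF assms(1) _ z(1)] mi by (metis One_nat_def atLeastAtMost_iff le_trans)
    \<comment> \<open>A point on a third edge at distance \<open>s > 0\<close> from the center is a
      detour: the distances through it add up to
      \<open>\<bar>x\<bar> + \<bar>y\<bar> + 2 * s\<close>, more than
      \<open>\<bar>x - y\<bar>\<close>.\<close>
    have "\<exists>t. z = ?L t"
    proof (rule ccontr)
      assume no: "\<nexists>t. z = ?L t"
      have "j \<noteq> m" "j \<noteq> i"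
        using no j(2) unfolding j(3)
        by (auto simp: star_line_def dest: spec[of _ s] spec[of _ "-s"] split: if_splits)
          (metis add.inverse_inverse le_less neg_less_0_iff_less not_le star_point_def)+
      moreover have "s \<noteq> 0"
        using no j(3) by (auto simp: star_line_def star_point_def dest: spec[of _ 0])
      ultimately have "?d (?L x) z = \<bar>x\<bar> + s" "?d z (?L y) = s + \<bar>y\<bar>" "s > 0"
        using j assms by (auto simp: star_line_def star_dist_star_point)
      then show False
        using z(2) by (simp add: d)
    qed
    then obtain t where t: "z = ?L t" by blast
    then have "t \<in> {x..y}"
      using z(2) xy(3) by (auto simp: d)
    then show "z \<in> ?L ` {x..y}"
      using t by blast
  next
    fix z assume "z \<in> ?L ` {x..y}"
    then obtain t where "t \<in> {x..y}" "z = ?L t" by blast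
    then show "z \<in> {z \<in> star n. ?d (?L x) z + ?d z (?L y) = ?d (?L x) (?L y)}"
      using L[of t] xy by (auto simp: d)
  qed
qed

section \<open>Finite sets of reals with unit gaps\<close>

definition unit_run :: "real \<Rightarrow> nat \<Rightarrow> real set" where
  "unit_run x N = (\<lambda>j. x + real j) ` {..<N}"

lemma card_unit_run [simp]: "card (unit_run x N) = N"
  unfolding unit_run_def by (subst card_image) (auto simp: inj_on_def)

lemma finite_unit_run [simp]: "finite (unit_run x N)"
  by (simp add: unit_run_def)

lemma unit_run_0 [simp]: "unit_run x 0 = {}"
  by (simp add: unit_run_def)

lemma Min_unit_run:
  assumes "N > 0"
  shows "Min (unit_run x N) = x"
  using assms by (intro Min_eqI) (auto simp: unit_run_def)

lemma unit_run_eqD: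
  assumes "unit_run x N = unit_run y M"
  shows "N = M" "N > 0 \<Longrightarrow> x = y"
proof -
  show "N = M"
    using assms card_unit_run by metis
  then show "N > 0 \<Longrightarrow> x = y"
    using assms Min_unit_run by metis
qed

text \<open>Counting the points between the minimum and \<open>y\<close> shows that \<open>y\<close>
  is the minimum plus a natural number below \<open>card T\<close>. So \<open>T\<close> is contained
  in a run of the same size and equals it.\<close>

lemma unit_run_iff:
  "(finite T \<and> (\<forall>x\<in>T. \<forall>y\<in>T. x \<le> y \<longrightarrow> real (card (T \<inter> {x..y})) = 1 + (y - x)))
    \<longleftrightarrow> (\<exists>x N. T = unit_run x N)" (is "?L \<longleftrightarrow> ?R")
proof
  assume ?L
  then have fin: "finite T" and c: "\<And>x y. x \<in> T \<Longrightarrow> y \<in> T \<Longrightarrow> x \<le> y \<Longrightarrow> real (card (T \<inter> {x..y})) = 1 + (y - x)"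
    by blast+
  show ?R
  proof (cases "T = {}")
    case True
    then show ?thesis by (metis unit_run_0)
  next
    case False
    define x where "x = Min T"
    have x: "x \<in> T" "\<And>y. y \<in> T \<Longrightarrow> x \<le> y"
      using fin False by (auto simp: x_def)
    have "T \<subseteq> unit_run x (card T)"
    proof
      fix y assume y: "y \<in> T"
      define j where "j = card (T \<inter> {x..y}) - 1"
      have "x \<in> T \<inter> {x..y}"
        using x y by auto
      then have pos: "card (T \<inter> {x..y}) > 0"
        using fin by (metis card_gt_0_iff emptyE finite_Int)
      moreover have "card (T \<inter> {x..y}) \<le> card T"
        using fin by (intro card_mono) auto
      ultimately have "j < card T"
        unfolding j_def by linarith
      moreover have "y = x + real j"
        using c[OF x(1) y x(2)[OF y]] pos by (simp add: j_def of_nat_diff Suc_leI)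
      ultimately show "y \<in> unit_run x (card T)"
        by (auto simp: unit_run_def)
    qed
    then have "T = unit_run x (card T)"
      by (intro card_subset_eq) auto
    then show ?thesis by blast
  qed
next
  assume ?R
  then obtain x N where T: "T = unit_run x N" by blast
  have "real (card (T \<inter> {y..z})) = 1 + (z - y)" if yz: "y \<in> T" "z \<in> T" "y \<le> z" for y z
  proof -
    obtain i j where ij: "y = x + real i" "z = x + real j" "i < N" "j < N"
      using yz(1,2) by (auto simp: T unit_run_def)
    then have "i \<le> j"
      using yz(3) by simp
    have "T \<inter> {y..z} = (\<lambda>j. x + real j) ` {i..j}"
      using ij by (auto simp: T unit_run_def)
    then have "card (T \<inter> {y..z}) = card {i..j}"
      by (simp add: card_image inj_on_def)
    then show ?thesis
      using ij \<open>i \<le> j\<close> by (simp add: of_nat_diff)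
  qed
  then show ?L
    using T by simp
qed

text \<open>The line embeds isometrically with intervals going to segments, so chains on two edges
  are chains of reals.\<close>

lemma star_chain_star_line_iff:
  assumes "\<kappa> > 0" and mi: "m \<in> {1..n}" "i \<in> {1..n}" "m \<noteq> i" and T: "T \<subseteq> {-\<kappa>..\<kappa>}"
  shows "star_chain n \<kappa> (star_line \<kappa> m i ` T) \<longleftrightarrow> (\<exists>x N. T = unit_run x N)"
proof -
  let ?L = "star_line \<kappa> m i"
  have inj: "inj ?L"
    using assms by (intro inj_star_line) auto
  have d: "star_dist \<kappa> (?L s) (?L t) = \<bar>s - t\<bar>" for s t
    using assms by (intro star_dist_star_line) auto
  have L: "?L t \<in> star n" if "t \<in> {-\<kappa>..\<kappa>}" for t
    using assms that by (intro star_line_in_star)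
  have card: "card (?L ` T \<inter> star_segment n \<kappa> (?L x) (?L y)) = card (T \<inter> {x..y})"
    if "x \<in> T" "y \<in> T" "x \<le> y" for x y
  proof -
    have "star_segment n \<kappa> (?L x) (?L y) = ?L ` {x..y}"
      using that T by (intro star_segment_star_line assms) auto
    then have "?L ` T \<inter> star_segment n \<kappa> (?L x) (?L y) = ?L ` (T \<inter> {x..y})"
      using inj by (simp add: image_Int)
    then show ?thesis
      by (simp add: card_image inj_on_subset[OF inj])
  qed
  \<comment> \<open>The chain condition speaks of pairs in both orders, \<open>unit_run_iff\<close>
    only of \<open>x \<le> y\<close>.\<close>
  have comm: "star_segment n \<kappa> (?L x) (?L y) = star_segment n \<kappa> (?L y) (?L x)"
    if "x \<in> T" "y \<in> T" for x y
  proof -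
    have "?L x \<in> star n" "?L y \<in> star n"
      using that T L by auto
    moreover have "star_dist \<kappa> u v = star_dist \<kappa> v u" for u v
      by (auto simp: star_dist_def simplicial_dist_def)
    ultimately show ?thesis
      using assms(1) by (auto simp: star_segment_eq)
  qed
  have "star_chain n \<kappa> (?L ` T) \<longleftrightarrow> finite T \<and> (\<forall>x\<in>T. \<forall>y\<in>T.
      real (card (?L ` T \<inter> star_segment n \<kappa> (?L x) (?L y))) = 1 + \<bar>x - y\<bar>)"
    using L T inj by (auto simp: star_chain_def d finite_image_iff inj_on_subset)
  also have "\<dots> \<longleftrightarrow> finite T \<and> (\<forall>x\<in>T. \<forall>y\<in>T. x \<le> y \<longrightarrow> real (card (T \<inter> {x..y})) = 1 + (y - x))"
  proof (intro conj_cong refl iffI ballI impI)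
    fix x y
    assume "\<forall>x\<in>T. \<forall>y\<in>T. real (card (?L ` T \<inter> star_segment n \<kappa> (?L x) (?L y))) = 1 + \<bar>x - y\<bar>"
      "x \<in> T" "y \<in> T" "x \<le> y"
    then show "real (card (T \<inter> {x..y})) = 1 + (y - x)"
      using card[of x y] by (metis abs_minus_commute abs_of_nonneg diff_ge_0_iff_ge)
  next
    fix x y
    assume *: "\<forall>x\<in>T. \<forall>y\<in>T. x \<le> y \<longrightarrow> real (card (T \<inter> {x..y})) = 1 + (y - x)"
      and xy: "x \<in> T" "y \<in> T"
    show "real (card (?L ` T \<inter> star_segment n \<kappa> (?L x) (?L y))) = 1 + \<bar>x - y\<bar>"
    proof (cases "x \<le> y")
      case True
      then show ?thesis
        using * xy card by simp
    next
      case False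
      then show ?thesis
        using * xy card[of y x] comm[OF xy] by simp
    qed
  qed
  finally show ?thesis
    by (simp only: unit_run_iff)
qed

text \<open>Cut the run at \<open>p = Min S\<close>, which is \<open>x + j0\<close>. What lies at or
  above \<open>p\<close> is nonnegative, hence in \<open>S\<close>: it could come from
  \<open>S'\<close> only as 0, which then is in \<open>S\<close> too. The \<open>j0\<close> elements
  below \<open>p\<close> are \<open>p - 1, p - 2, ...\<close> and reflect to the run from
  \<open>1 - p\<close>.\<close>

lemma union_unit_runD:
  assumes S: "finite S" "S \<noteq> {}" "S \<subseteq> {0..}" "S' \<subseteq> {0..}" "0 \<in> S' \<Longrightarrow> 0 \<in> S"
    and run: "S \<union> uminus ` S' = unit_run x N"
  shows "(\<exists>a. S = unit_run (Min S) a) \<and> (\<exists>b. S' - {0} = unit_run (1 - Min S) b)"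
proof -
  define p where "p = Min S"
  have p: "p \<in> S" "\<And>s. s \<in> S \<Longrightarrow> p \<le> s" "0 \<le> p"
    using S by (auto simp: p_def)
  then obtain j0 where j0: "j0 < N" "p = x + real j0"
    using run by (auto simp: unit_run_def)
  have mem: "t \<in> unit_run x N \<longleftrightarrow> t \<in> S \<or> - t \<in> S'" for t
    unfolding run[symmetric] by force
  have "S = unit_run p (N - j0)"
  proof (intro equalityI subsetI)
    fix s assume s: "s \<in> S"
    then obtain j where j: "j < N" "s = x + real j"
      using mem[of s] by (auto simp: unit_run_def)
    then have "j0 \<le> j"
      using p(2)[OF s] j0 by simp
    then show "s \<in> unit_run p (N - j0)"
      using j j0 unfolding unit_run_def by (intro image_eqI[of _ _ "j - j0"]) (auto simp: of_nat_diff)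
  next
    fix s assume "s \<in> unit_run p (N - j0)"
    then obtain j where j: "j < N - j0" "s = p + real j"
      by (auto simp: unit_run_def)
    then have "s = x + real (j0 + j)" "j0 + j < N"
      using j0 by auto
    then have "s \<in> unit_run x N"
      unfolding unit_run_def by blast
    then consider "s \<in> S" | "- s \<in> S'"
      using mem by blast
    then show "s \<in> S"
    proof cases
      case 2
      then have "s = 0"
        using S(4) j(2) p(3) by force
      then show ?thesis
        using 2 S(5) by simp
    qed
  qed
  moreover have "S' - {0} = unit_run (1 - p) j0"
  proof (intro equalityI subsetI)
    fix s assume s: "s \<in> S' - {0}"
    then obtain j where j: "j < N" "- s = x + real j"
      using mem[of "- s"] by (auto simp: unit_run_def)
    have "s > 0"
      using s S(4) by force
    then have "j < j0"
      using j j0 p(3) by linarith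
    then show "s \<in> unit_run (1 - p) j0"
      using j j0 unfolding unit_run_def by (intro image_eqI[of _ _ "j0 - 1 - j"]) (auto simp: of_nat_diff)
  next
    fix s assume "s \<in> unit_run (1 - p) j0"
    then obtain j where j: "j < j0" "s = 1 - p + real j"
      by (auto simp: unit_run_def)
    then have "- s = x + real (j0 - 1 - j)" "j0 - 1 - j < N"
      using j0 by (auto simp: of_nat_diff)
    then have "- s \<in> unit_run x N"
      unfolding unit_run_def by blast
    moreover have "- s < p"
      using j by simp
    then have "- s \<notin> S"
      using p(2) by force
    ultimately have "s \<in> S'"
      using mem[of "- s"] by simp
    moreover have "s \<noteq> 0"
      using \<open>- s \<notin> S\<close> S(5) \<open>s \<in> S'\<close> by auto
    ultimately show "s \<in> S' - {0}" by blast
  qed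
  ultimately show ?thesis
    unfolding p_def by blast
qed

text \<open>The run \<open>1 - p, ..., b - p\<close> reflects to \<open>p - b, ..., p - 1\<close>,
  which continues into the run from \<open>p\<close> without a gap. A 0 in \<open>S'\<close> adds
  nothing, being in the run from \<open>p\<close> already.\<close>

lemma union_unit_runI:
  assumes "0 \<in> S' \<Longrightarrow> 0 \<in> unit_run p a" "S' - {0} = unit_run (1 - p) b"
  shows "unit_run p a \<union> uminus ` S' = unit_run (p - real b) (b + a)"
proof -
  have "uminus ` unit_run (1 - p) b = unit_run (p - real b) b"
  proof (intro equalityI subsetI)
    fix t assume "t \<in> uminus ` unit_run (1 - p) b"
    then obtain j where "j < b" "t = - (1 - p + real j)"
      by (auto simp: unit_run_def)
    then show "t \<in> unit_run (p - real b) b"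
      unfolding unit_run_def by (intro image_eqI[of _ _ "b - 1 - j"]) (auto simp: of_nat_diff)
  next
    fix t assume "t \<in> unit_run (p - real b) b"
    then obtain j where "j < b" "t = p - real b + real j"
      by (auto simp: unit_run_def)
    then show "t \<in> uminus ` unit_run (1 - p) b"
      unfolding unit_run_def image_image
      by (intro image_eqI[of _ _ "b - 1 - j"]) (auto simp: of_nat_diff)
  qed
  moreover have "unit_run (p - real b) (b + a) = unit_run (p - real b) b \<union> unit_run p a"
  proof -
    have "{..<b + a} = {..<b} \<union> (\<lambda>j. b + j) ` {..<a}"
    proof (intro equalityI subsetI)
      fix j assume "j \<in> {..<b + a}"
      then show "j \<in> {..<b} \<union> (\<lambda>j. b + j) ` {..<a}"
        by (cases "j < b") (auto intro!: image_eqI[of _ _ "j - b"])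
    qed auto
    then show ?thesis
      by (simp add: unit_run_def image_Un image_image)
  qed
  moreover have "unit_run p a \<union> uminus ` S' = unit_run p a \<union> uminus ` (S' - {0})"
    using assms(1) by force
  ultimately show ?thesis
    using assms(2) by auto
qed

section \<open>Regular configurations as runs of points\<close>

text \<open>The center, if it is in \<open>c\<close>, contributes 0 on every edge; hence the
  \<open>- {0}\<close> wherever edges other than the governing one are described.\<close>

definition edge_coords :: "real \<Rightarrow> nat \<Rightarrow> (nat \<times> real) set \<Rightarrow> real set" where
  "edge_coords \<kappa> i c = {s \<in> {0..\<kappa>}. star_point \<kappa> i s \<in> c}"

lemma edge_coords_zero_iff:
  assumes "\<kappa> > 0"
  shows "0 \<in> edge_coords \<kappa> i c \<longleftrightarrow> (0, 0) \<in> c"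
  using assms by (simp add: edge_coords_def star_point_def)

lemma inj_star_point:
  assumes "\<kappa> > 0" "i \<ge> 1"
  shows "inj (star_point \<kappa> i)"
  using assms by (auto simp: inj_on_def star_point_eq_iff)

lemma edge_part_eq:
  assumes "\<kappa> > 0" "i \<in> {1..n}"
  shows "edge_part n \<kappa> i c = star_point \<kappa> i ` edge_coords \<kappa> i c"
proof -
  have "star_segment n \<kappa> (star_vertex 0) (star_vertex i) = star_point \<kappa> i ` {0..\<kappa>}"
  proof (intro equalityI subsetI)
    have v: "star_vertex 0 = star_point \<kappa> i 0" "star_vertex i = star_point \<kappa> i \<kappa>"
      using assms by (auto simp: star_vertex_def star_point_def)
    have s: "star_point \<kappa> i 0 \<in> star n" "star_point \<kappa> i \<kappa> \<in> star n"
      using assms by (auto intro!: star_point_in_star)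
    note seg = star_segment_eq[OF assms(1) s]
    show "z \<in> star_point \<kappa> i ` {0..\<kappa>}" if "z \<in> star_segment n \<kappa> (star_vertex 0) (star_vertex i)" for z
    proof -
      from that have z: "z \<in> star n" "star_dist \<kappa> (star_point \<kappa> i 0) z + star_dist \<kappa> z (star_point \<kappa> i \<kappa>) =
          star_dist \<kappa> (star_point \<kappa> i 0) (star_point \<kappa> i \<kappa>)"
        unfolding v seg by auto
      have n: "n \<ge> 1" using assms by auto
      obtain j s where j: "j \<in> {1..n}" "s \<in> {0..\<kappa>}" "z = star_point \<kappa> j s"
        using in_star_cases[OF assms(1) n z(1)] .
      have "j = i \<or> s = 0"
        using z(2) j assms by (auto simp: star_dist_star_point split: if_splits)
      then show ?thesis
        using j by (auto simp: star_point_def)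
    qed
    show "z \<in> star_segment n \<kappa> (star_vertex 0) (star_vertex i)" if "z \<in> star_point \<kappa> i ` {0..\<kappa>}" for z
      using that assms unfolding v seg by (auto simp: star_dist_star_point intro!: star_point_in_star)
  qed
  then show ?thesis
    by (auto simp: edge_part_def edge_coords_def)
qed

lemma config_eq_Union_edges:
  assumes "\<kappa> > 0" "n \<ge> 1" "c \<subseteq> star n"
  shows "c = (\<Union>i\<in>{1..n}. star_point \<kappa> i ` edge_coords \<kappa> i c)"
proof (intro equalityI subsetI)
  fix x assume "x \<in> c"
  then show "x \<in> (\<Union>i\<in>{1..n}. star_point \<kappa> i ` edge_coords \<kappa> i c)"
    using in_star_cases[OF assms(1,2), of x] assms(3) unfolding edge_coords_def by blast
qed (auto simp: edge_coords_def)

lemma edge_parts_eq_star_line: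
  assumes "\<kappa> > 0" "m \<in> {1..n}" "i \<in> {1..n}"
  shows "edge_part n \<kappa> m c \<union> edge_part n \<kappa> i c
    = star_line \<kappa> m i ` (edge_coords \<kappa> m c \<union> uminus ` edge_coords \<kappa> i c)"
proof -
  have "star_point \<kappa> m s = star_line \<kappa> m i s" if "s \<in> edge_coords \<kappa> m c" for s
    using that by (simp add: edge_coords_def star_line_def)
  moreover have "star_point \<kappa> i s = star_line \<kappa> m i (- s)" if "s \<in> edge_coords \<kappa> i c" for s
    using that by (auto simp: edge_coords_def star_line_def star_point_def)
  ultimately show ?thesis
    using assms by (simp add: edge_part_eq image_Un image_image cong: image_cong)
qed

lemma edge_part_eq_star_line:
  assumes "\<kappa> > 0" "m \<in> {1..n}"
  shows "edge_part n \<kappa> m c = star_line \<kappa> m i ` edge_coords \<kappa> m c"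
  using assms by (auto simp: edge_part_eq edge_coords_def star_line_def image_iff)

lemma edge_coords_bound: "edge_coords \<kappa> i c \<subseteq> {0..\<kappa>}"
  by (auto simp: edge_coords_def)

lemma star_chain_edge_parts_iff:
  assumes "\<kappa> > 0" "m \<in> {1..n}" "i \<in> {1..n}" "m \<noteq> i"
  shows "star_chain n \<kappa> (edge_part n \<kappa> m c \<union> edge_part n \<kappa> i c)
    \<longleftrightarrow> (\<exists>x N. edge_coords \<kappa> m c \<union> uminus ` edge_coords \<kappa> i c = unit_run x N)"
  unfolding edge_parts_eq_star_line[OF assms(1-3)]
  using assms edge_coords_bound[of \<kappa> m c] edge_coords_bound[of \<kappa> i c]
  by (intro star_chain_star_line_iff) force+

text \<open>A configuration without an arm on edge \<open>i\<close> has \<open>a i = 0\<close>. The governing arm starts at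
  distance \<open>p\<close> from the center, and the chain condition then makes all the other arms start at
  distance \<open>1 - p\<close>. The center itself, present only if \<open>p = 0\<close>, is counted
  for the governing arm only.\<close>

definition run_start :: "nat \<Rightarrow> real \<Rightarrow> nat \<Rightarrow> real" where
  "run_start m p i = (if i = m then p else 1 - p)"

definition run_config :: "real \<Rightarrow> nat \<Rightarrow> (nat \<Rightarrow> nat) \<Rightarrow> nat \<Rightarrow> real \<Rightarrow> (nat \<times> real) set" where
  "run_config \<kappa> n a m p = (\<Union>i\<in>{1..n}. star_point \<kappa> i ` unit_run (run_start m p i) (a i))"

text \<open>Vanishing off \<open>{1..n}\<close> makes the data finite in number and comparable as
  functions. The last conjunct stands for the second arm, which has to contain a point other than
  the center.\<close>

definition run_data :: "nat \<Rightarrow> nat \<Rightarrow> ((nat \<Rightarrow> nat) \<times> nat) set" where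
  "run_data k n = {(a, m). (\<forall>i. i \<notin> {1..n} \<longrightarrow> a i = 0) \<and> sum a {1..n} = k \<and>
     m \<in> {1..n} \<and> 0 < a m \<and> (\<exists>i\<in>{1..n} - {m}. 0 < a i)}"

lemma run_data_bound:
  assumes "(a, m) \<in> run_data k n" "i \<in> {1..n}"
  shows "a i < k"
proof -
  obtain j where j: "j \<in> {1..n} - {i}" "0 < a j"
    using assms unfolding run_data_def by (cases "i = m") blast+
  have "a i + sum a ({1..n} - {i}) = k"
    using assms sum.remove[of "{1..n}" i a] by (auto simp: run_data_def)
  moreover have "a j \<le> sum a ({1..n} - {i})"
    using j by (intro member_le_sum) auto
  ultimately show ?thesis
    using j by linarith
qed

text \<open>Another edge is occupied, so a run has at most \<open>k - 1\<close> points. It starts at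
  distance at most 1 and thus ends no further out than \<open>1 + (k - 2) = k - 1\<close>; this is
  the origin of the bound on \<open>\<kappa>\<close>.\<close>

lemma unit_run_bound:
  assumes "\<kappa> \<ge> real k - 1" "(a, m) \<in> run_data k n" "i \<in> {1..n}" "0 \<le> p" "p < 1"
  shows "unit_run (run_start m p i) (a i) \<subseteq> {0..\<kappa>}"
proof
  fix s assume "s \<in> unit_run (run_start m p i) (a i)"
  then obtain j where j: "j < a i" "s = run_start m p i + real j"
    by (auto simp: unit_run_def)
  have "0 \<le> run_start m p i" "run_start m p i \<le> 1"
    using assms by (auto simp: run_start_def)
  moreover have "j + 2 \<le> k"
    using run_data_bound[OF assms(2,3)] j by simp
  then have "real j + 2 \<le> real k"
    by linarith
  ultimately show "s \<in> {0..\<kappa>}"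
    using j assms(1) by auto
qed

lemma run_config_image:
  "run_config \<kappa> n a m p =
    (\<lambda>(i, j). star_point \<kappa> i (run_start m p i + real j)) ` (SIGMA i:{1..n}. {..<a i})"
  by (force simp: run_config_def unit_run_def)

text \<open>For \<open>p < 1\<close> every run except the one on \<open>m\<close> starts at a
  positive distance, so runs on different edges share no point, not even the center.\<close>

lemma inj_on_run_config:
  assumes "\<kappa> > 0" "0 \<le> p" "p < 1"
  shows "inj_on (\<lambda>(i, j). star_point \<kappa> i (run_start m p i + real j)) (SIGMA i:{1..n}. {..<a i})"
  using assms by (auto simp: inj_on_def star_point_eq_iff run_start_def split: if_splits)

lemma card_run_config:
  assumes "\<kappa> > 0" "0 \<le> p" "p < 1"
  shows "card (run_config \<kappa> n a m p) = sum a {1..n}"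
  unfolding run_config_image card_image[OF inj_on_run_config[OF assms]] by simp

text \<open>The extra 0 is the center, which for \<open>p = 0\<close> belongs to the run on
  \<open>m\<close> but is seen from every edge. The parameters of a configuration are later read off
  from these coordinates.\<close>

lemma edge_coords_run_config:
  assumes \<kappa>: "\<kappa> > 0" "\<kappa> \<ge> real k - 1" and am: "(a, m) \<in> run_data k n"
    and i: "i \<in> {1..n}" and p: "0 \<le> p" "p < 1"
  shows "edge_coords \<kappa> i (run_config \<kappa> n a m p) =
    unit_run (run_start m p i) (a i) \<union> (if p = 0 then {0} else {})"
proof -
  have m: "m \<in> {1..n}" "0 < a m"
    using am by (auto simp: run_data_def)
  have zero: "0 \<in> unit_run (run_start m p j) (a j) \<longleftrightarrow> j = m \<and> p = 0" for j
    using p m by (auto simp: unit_run_def run_start_def add_nonneg_eq_0_iff)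
  have "star_point \<kappa> i s \<in> run_config \<kappa> n a m p \<longleftrightarrow>
      s \<in> unit_run (run_start m p i) (a i) \<or> s = 0 \<and> p = 0" for s
  proof -
    have "star_point \<kappa> i s \<in> run_config \<kappa> n a m p \<longleftrightarrow>
        (\<exists>j\<in>{1..n}. s \<in> unit_run (run_start m p j) (a j) \<and> (s = 0 \<or> i = j))"
      using \<kappa>(1) i by (auto simp: run_config_def image_iff star_point_eq_iff)
    then show ?thesis
      using i m(1) zero by (cases "s = 0") auto
  qed
  then show ?thesis
    using unit_run_bound[OF \<kappa>(2) am i p] \<kappa>(1) by (auto simp: edge_coords_def)
qed

lemma run_config_in_regular_configs:
  assumes \<kappa>: "\<kappa> > 0" "\<kappa> \<ge> real k - 1" and am: "(a, m) \<in> run_data k n" and p: "0 \<le> p" "p < 1"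
  shows "run_config \<kappa> n a m p \<in> regular_configs k n \<kappa>"
proof -
  let ?c = "run_config \<kappa> n a m p"
  obtain i0 where m: "m \<in> {1..n}" "0 < a m" and i0: "i0 \<in> {1..n}" "i0 \<noteq> m" "0 < a i0"
    and sum: "sum a {1..n} = k"
    using am unfolding run_data_def by blast
  have "?c \<subseteq> star n"
    using unit_run_bound[OF \<kappa>(2) am _ p] star_point_in_star[OF \<kappa>(1)]
    unfolding run_config_def by blast
  moreover have "finite ?c"
    by (simp add: run_config_def)
  ultimately have conf: "?c \<in> configs k (star n)"
    using card_run_config[OF \<kappa>(1) p, of n a m] sum by (simp add: configs_def)
  note coords = edge_coords_run_config[OF \<kappa> am _ p]
  have Sm: "edge_coords \<kappa> m ?c = unit_run p (a m)"
    using coords[OF m(1)] m(2) by (auto simp: run_start_def unit_run_def image_iff)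
  have Si: "edge_coords \<kappa> i ?c - {0} = unit_run (1 - p) (a i)" if "i \<in> {1..n}" "i \<noteq> m" for i
    using coords[OF that(1)] that(2) p by (auto simp: run_start_def unit_run_def)
  have chain: "star_chain n \<kappa> (edge_part n \<kappa> m ?c \<union> edge_part n \<kappa> i ?c)" if i: "i \<in> {1..n}" for i
  proof (cases "i = m")
    case True
    \<comment> \<open>The governing arm alone must be a chain too; it is viewed on the line through
      some other edge, here \<open>i0\<close>.\<close>
    have "edge_coords \<kappa> m ?c \<subseteq> {-\<kappa>..\<kappa>}"
      using edge_coords_bound[of \<kappa> m ?c] \<kappa>(1) by force
    then have "star_chain n \<kappa> (star_line \<kappa> m i0 ` edge_coords \<kappa> m ?c)"
      using star_chain_star_line_iff[OF \<kappa>(1) m(1) i0(1) i0(2)[symmetric]] Sm by blast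
    then show ?thesis
      using True m \<kappa>(1) edge_part_eq_star_line[of \<kappa> m n ?c i0] by simp
  next
    case False
    have "edge_coords \<kappa> m ?c \<union> uminus ` edge_coords \<kappa> i ?c = unit_run (p - real (a i)) (a i + a m)"
      unfolding Sm
    proof (rule union_unit_runI)
      show "0 \<in> unit_run p (a m)" if "0 \<in> edge_coords \<kappa> i ?c"
        using that unfolding Sm[symmetric] edge_coords_zero_iff[OF \<kappa>(1)] .
    qed (rule Si[OF i False])
    then show ?thesis
      using star_chain_edge_parts_iff[OF \<kappa>(1) m(1) i False[symmetric]] by blast
  qed
  have ne: "edge_coords \<kappa> m ?c \<noteq> {}"
    using Sm m(2) card_unit_run by (metis card.empty less_irrefl)
  then have "edge_part n \<kappa> m ?c \<noteq> {}"
    using m \<kappa>(1) by (simp add: edge_part_eq)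
  then have arm: "edge_part n \<kappa> m ?c \<in> arms n \<kappa> ?c"
    using m unfolding arms_def by blast
  have "1 - p \<in> edge_coords \<kappa> i0 ?c"
    using Si[OF i0(1,2)] i0(3) by (force simp: unit_run_def)
  then have x: "star_point \<kappa> i0 (1 - p) \<in> edge_part n \<kappa> i0 ?c"
    using i0 \<kappa>(1) by (auto simp: edge_part_eq)
  then have arm': "edge_part n \<kappa> i0 ?c \<in> arms n \<kappa> ?c"
    using i0 unfolding arms_def by blast
  \<comment> \<open>Since \<open>1 - p > 0\<close>, this point is not the center and tells the two
    arms apart.\<close>
  have "star_point \<kappa> i0 (1 - p) \<notin> edge_part n \<kappa> m ?c"
    using i0 m \<kappa>(1) p by (auto simp: edge_part_eq star_point_eq_iff)
  then have "card {edge_part n \<kappa> m ?c, edge_part n \<kappa> i0 ?c} = 2"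
    using x by (auto simp: card_2_iff)
  moreover have fin: "finite (arms n \<kappa> ?c)"
    by (simp add: arms_def)
  have "card {edge_part n \<kappa> m ?c, edge_part n \<kappa> i0 ?c} \<le> card (arms n \<kappa> ?c)"
    using arm arm' by (intro card_mono fin) simp
  ultimately have "2 \<le> card (arms n \<kappa> ?c)"
    by linarith
  moreover have "governing_arm n \<kappa> ?c (edge_part n \<kappa> m ?c)"
    using arm chain by (simp add: governing_arm_def)
  ultimately have "regular_config n \<kappa> ?c"
    unfolding regular_config_def by (intro conjI exI)
  then show ?thesis
    using conf by (simp add: regular_configs_def)
qed

text \<open>A chain through the center on a single edge has the center as a second governing arm.\<close>

lemma governing_arm_proper:
  assumes \<kappa>: "\<kappa> > 0" and c: "c \<subseteq> star n" and reg: "regular_config n \<kappa> c"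
  obtains m where "m \<in> {1..n}" "governing_arm n \<kappa> c (edge_part n \<kappa> m c)" "edge_part n \<kappa> m c \<noteq> c"
proof -
  obtain A where A: "governing_arm n \<kappa> c A" and two: "2 \<le> card (arms n \<kappa> c)"
    using reg by (auto simp: regular_config_def)
  then obtain m where m: "m \<in> {1..n}" "A = edge_part n \<kappa> m c" "A \<noteq> {}"
    by (auto simp: governing_arm_def arms_def)
  show ?thesis
  proof (cases "A = c")
    case False
    then show ?thesis
      using that m A by blast
  next
    case True
    \<comment> \<open>All of \<open>c\<close> lies on edge \<open>m\<close>, so a second arm can
      only be the center. Letting it govern leaves points of edge \<open>m\<close> outside the
      governing arm.\<close>
    have "\<not> arms n \<kappa> c \<subseteq> {A}"
      using two card_mono[of "{A}" "arms n \<kappa> c"] by auto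
    then obtain i where i: "i \<in> {1..n}" "edge_part n \<kappa> i c \<noteq> {}" "edge_part n \<kappa> i c \<noteq> A"
      by (auto simp: arms_def)
    have part: "edge_part n \<kappa> j c = {(0, 0)}" if j: "j \<in> {1..n}" "j \<noteq> m" "edge_part n \<kappa> j c \<noteq> {}" for j
    proof -
      have "edge_part n \<kappa> j c \<subseteq> edge_part n \<kappa> m c"
        using True m by (auto simp: edge_part_def)
      then have "edge_part n \<kappa> j c \<subseteq> {(0, 0)}"
        using j m \<kappa> by (auto simp: edge_part_eq star_point_def split: if_splits)
      then show ?thesis
        using j by blast
    qed
    have im: "i \<noteq> m" using i m by blast
    have z: "edge_part n \<kappa> i c = {(0, 0)}"
      using part[OF i(1) im i(2)] .
    have "star_chain n \<kappa> (edge_part n \<kappa> i c \<union> edge_part n \<kappa> j c)" if j: "j \<in> {1..n}" for j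
    proof (cases "j = m")
      case True
      then show ?thesis
        using A i m by (auto simp: governing_arm_def Un_commute)
    next
      case False
      then have "edge_part n \<kappa> i c \<union> edge_part n \<kappa> j c = {(0, 0)}"
        using part[OF j False] z by blast
      moreover have "star_chain n \<kappa> {(0, 0)}"
      proof -
        have o: "(0, 0) \<in> star n"
          by (simp add: star_def)
        have d: "star_dist \<kappa> (0, 0) (0, 0) = 0"
          by (simp add: star_dist_def simplicial_dist_def)
        have "(0, 0) \<in> star_segment n \<kappa> (0, 0) (0, 0)"
          using o d by (simp add: star_segment_eq[OF \<kappa> o o])
        then show ?thesis
          using o d by (simp add: star_chain_def)
      qed
      ultimately show ?thesis by simp
    qed
    then have "governing_arm n \<kappa> c (edge_part n \<kappa> i c)"
      using i by (auto simp: governing_arm_def arms_def)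
    then show ?thesis
      using that i True by blast
  qed
qed

text \<open>With \<open>p\<close> the first coordinate on the governing arm, comparison with each
  other edge yields a run from \<open>1 - p\<close> there. A governing arm that is not all of
  \<open>c\<close> is chosen so that some other edge carries a point besides the center.\<close>

lemma regular_config_run_config:
  assumes \<kappa>: "\<kappa> > 0" and c: "c \<in> regular_configs k n \<kappa>"
  obtains a m p where "(a, m) \<in> run_data k n" "0 \<le> p" "p < 1" "c = run_config \<kappa> n a m p"
proof -
  have cs: "c \<subseteq> star n" "finite c" "card c = k" and reg: "regular_config n \<kappa> c"
    using c by (auto simp: regular_configs_def configs_def)
  obtain m where m: "m \<in> {1..n}" "governing_arm n \<kappa> c (edge_part n \<kappa> m c)" "edge_part n \<kappa> m c \<noteq> c"
    using governing_arm_proper[OF \<kappa> cs(1) reg] .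
  let ?S = "\<lambda>i. edge_coords \<kappa> i c"
  define p where "p = Min (?S m)"
  have fin: "finite (?S i)" if "i \<in> {1..n}" for i
  proof -
    have "finite (edge_part n \<kappa> i c)"
      using cs by (simp add: edge_part_def)
    then show ?thesis
      using that \<kappa> inj_star_point[OF \<kappa>, of i] by (simp add: edge_part_eq finite_image_iff inj_on_subset)
  qed
  have ne: "?S m \<noteq> {}"
    using m \<kappa> by (auto simp: governing_arm_def arms_def edge_part_eq)
  have p0: "0 \<le> p"
    using fin[OF m(1)] ne edge_coords_bound[of \<kappa> m c] by (auto simp: p_def)
  have pm: "p \<in> ?S m"
    using fin[OF m(1)] ne by (simp add: p_def)
  have run: "(\<exists>a. ?S m = unit_run p a) \<and> (\<exists>b. ?S i - {0} = unit_run (1 - p) b)"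
    if i: "i \<in> {1..n}" "i \<noteq> m" for i
  proof -
    have "star_chain n \<kappa> (edge_part n \<kappa> m c \<union> edge_part n \<kappa> i c)"
      using m i by (auto simp: governing_arm_def)
    then obtain x N where run: "?S m \<union> uminus ` ?S i = unit_run x N"
      using star_chain_edge_parts_iff[OF \<kappa> m(1) i(1)] i(2) by blast
    show ?thesis
      unfolding p_def
      by (rule union_unit_runD[OF fin[OF m(1)] ne _ _ _ run])
        (use edge_coords_bound[of \<kappa> m c] edge_coords_bound[of \<kappa> i c]
          edge_coords_zero_iff[OF \<kappa>] in auto)
  qed
  have "n \<ge> 1"
    using m by auto
  note un = config_eq_Union_edges[OF \<kappa> this cs(1)]
  obtain i0 s0 where i0: "i0 \<in> {1..n}" "s0 \<in> ?S i0" "star_point \<kappa> i0 s0 \<notin> edge_part n \<kappa> m c"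
  proof -
    have "edge_part n \<kappa> m c \<subseteq> c"
      by (auto simp: edge_part_def)
    then obtain x where "x \<in> c" "x \<notin> edge_part n \<kappa> m c"
      using m(3) by blast
    then show ?thesis
      using that equalityD1[OF un] by blast
  qed
  have i0m: "i0 \<noteq> m"
    using i0 \<kappa> by (auto simp: edge_part_eq)
  have s0: "s0 \<noteq> 0"
  proof
    assume "s0 = 0"
    then have "0 \<in> ?S m"
      using i0 edge_coords_zero_iff[OF \<kappa>] by blast
    then show False
      using i0 m(1) \<kappa> \<open>s0 = 0\<close> by (auto simp: edge_part_eq star_point_def)
  qed
  obtain am where am: "?S m = unit_run p am"
    using run[OF i0(1) i0m] by blast
  obtain b where b: "\<And>i. i \<in> {1..n} \<Longrightarrow> i \<noteq> m \<Longrightarrow> ?S i - {0} = unit_run (1 - p) (b i)"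
    using run by metis
  define a where "a i = (if i \<in> {1..n} then if i = m then am else b i else 0)" for i
  have "am > 0"
    using pm am by (cases am) auto
  have s0b: "s0 \<in> unit_run (1 - p) (b i0)"
    using b[OF i0(1) i0m] i0(2) s0 by blast
  then have "b i0 > 0"
    by (cases "b i0") auto
  \<comment> \<open>The nonempty run on \<open>i0\<close> starts at \<open>1 - p\<close> and omits
    0, while coordinates are nonnegative.\<close>
  have p1: "p < 1"
  proof -
    have "1 - p \<in> unit_run (1 - p) (b i0)"
      using \<open>b i0 > 0\<close> by (force simp: unit_run_def)
    then have "1 - p \<in> ?S i0 - {0}"
      using b[OF i0(1) i0m] by simp
    then show ?thesis
      using edge_coords_bound[of \<kappa> i0 c] by auto
  qed
  have c_eq: "c = run_config \<kappa> n a m p"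
  proof -
    have 0: "star_point \<kappa> i 0 = star_point \<kappa> m 0" for i
      by (simp add: star_point_def)
    have sub: "unit_run (run_start m p i) (a i) \<subseteq> ?S i" if "i \<in> {1..n}" for i
      using that am b[OF that] by (auto simp: run_start_def a_def)
    have sup: "?S i - {0} \<subseteq> unit_run (run_start m p i) (a i)" if "i \<in> {1..n}" for i
      using that am b[OF that] by (auto simp: run_start_def a_def)
    have "x \<in> run_config \<kappa> n a m p" if "x \<in> c" for x
    proof -
      obtain i s where x: "i \<in> {1..n}" "s \<in> ?S i" "x = star_point \<kappa> i s"
        using equalityD1[OF un] \<open>x \<in> c\<close> by blast
      show ?thesis
      proof (cases "s = 0")
        case True
        then have "0 \<in> ?S m"
          using x edge_coords_zero_iff[OF \<kappa>] by blast
        then have "0 \<in> unit_run (run_start m p m) (a m)"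
          using am m(1) by (simp add: run_start_def a_def)
        then show ?thesis
          using m(1) True 0 unfolding x(3) run_config_def by blast
      next
        case False
        then show ?thesis
          using x sup[OF x(1)] unfolding run_config_def by blast
      qed
    qed
    moreover have "run_config \<kappa> n a m p \<subseteq> c"
      using sub equalityD2[OF un] unfolding run_config_def by blast
    ultimately show ?thesis by blast
  qed
  have "(a, m) \<in> run_data k n"
  proof -
    have "sum a {1..n} = k"
      using card_run_config[OF \<kappa> p0 p1, of n a m] cs(3) c_eq by simp
    then show ?thesis
      using \<open>am > 0\<close> \<open>b i0 > 0\<close> m(1) i0(1) i0m by (auto simp: run_data_def a_def intro!: bexI[of _ i0])
  qed
  then show ?thesis
    using that p0 p1 c_eq by blast
qed

section \<open>Decomposition into arcs\<close>

text \<open>If exactly two arms start at \<open>p\<close> and \<open>1 - p\<close>, either of them can be taken as the governing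
  one, so that \<open>p \<le> 1/2\<close> is no restriction. With three or more arms the governing arm is unique
  for \<open>p > 1/2\<close>.\<close>

definition admissible :: "nat \<Rightarrow> (nat \<Rightarrow> nat) \<Rightarrow> real \<Rightarrow> bool" where
  "admissible n a p \<longleftrightarrow> 0 \<le> p \<and> p < 1 \<and> (p \<le> 1/2 \<or> 3 \<le> card {i \<in> {1..n}. 0 < a i})"

lemma run_config_swap:
  assumes am: "(a, m) \<in> run_data k n" and two: "card {i \<in> {1..n}. 0 < a i} < 3"
  obtains i where "(a, i) \<in> run_data k n" "run_config \<kappa> n a m p = run_config \<kappa> n a i (1 - p)"
proof -
  obtain i where m: "m \<in> {1..n}" "0 < a m" and i: "i \<in> {1..n}" "i \<noteq> m" "0 < a i"
    using am unfolding run_data_def by blast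
  have only: "j = m \<or> j = i" if "j \<in> {1..n}" "0 < a j" for j
  proof (rule ccontr)
    assume "\<not> (j = m \<or> j = i)"
    then have "card {m, i, j} = 3"
      using i by auto
    moreover have "card {m, i, j} \<le> card {i \<in> {1..n}. 0 < a i}"
      using that m i by (intro card_mono) auto
    ultimately show False
      using two by linarith
  qed
  have "(a, i) \<in> run_data k n"
    using am i m unfolding run_data_def by blast
  moreover have "unit_run (run_start m p j) (a j) = unit_run (run_start i (1 - p) j) (a j)"
    if "j \<in> {1..n}" for j
    using only[OF that] i(2) by (cases "a j = 0") (auto simp: run_start_def)
  then have "run_config \<kappa> n a m p = run_config \<kappa> n a i (1 - p)"
    unfolding run_config_def by (intro SUP_cong) simp_all
  ultimately show ?thesis
    using that by blast
qed

text \<open>For \<open>p > 0\<close> the center is absent and each edge carries a run, whose size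
  gives \<open>a\<close> and whose minimum gives the start. If \<open>m\<close> and
  \<open>m'\<close> differ, then \<open>p = 1 - p'\<close>. A third occupied edge gives
  \<open>p = p'\<close>, and without one admissibility bounds both by 1/2, so \<open>p = 1/2\<close>
  either way. At \<open>p = 0\<close> the center can be attributed to different edges, so
  \<open>m\<close> is determined only once \<open>a\<close> is known.\<close>

lemma run_config_eqD:
  assumes \<kappa>: "\<kappa> > 0" "\<kappa> \<ge> real k - 1"
    and am: "(a, m) \<in> run_data k n" and adm: "admissible n a p"
    and am': "(a', m') \<in> run_data k n" and adm': "admissible n a' p'"
    and eq: "run_config \<kappa> n a m p = run_config \<kappa> n a' m' p'"
  shows "p = p'" "p \<noteq> 0 \<Longrightarrow> a = a'" "p \<notin> {0, 1/2} \<Longrightarrow> m = m'" "a = a' \<Longrightarrow> p = 0 \<Longrightarrow> m = m'"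
proof -
  have p: "0 \<le> p" "p < 1" and p': "0 \<le> p'" "p' < 1"
    using adm adm' by (auto simp: admissible_def)
  have m: "m \<in> {1..n}" "0 < a m" and m': "m' \<in> {1..n}" "0 < a' m'"
    using am am' by (auto simp: run_data_def)
  have coords: "unit_run (run_start m p i) (a i) \<union> (if p = 0 then {0} else {}) =
      unit_run (run_start m' p' i) (a' i) \<union> (if p' = 0 then {0} else {})" if "i \<in> {1..n}" for i
    using edge_coords_run_config[OF \<kappa> am that p] edge_coords_run_config[OF \<kappa> am' that p'] eq by simp
  have pos: "0 \<notin> unit_run (run_start j q i) N" if "0 < q" "q < 1" for i j N and q :: real
  proof
    assume "0 \<in> unit_run (run_start j q i) N"
    then obtain l where "0 = run_start j q i + real l"
      by (auto simp: unit_run_def)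
    moreover have "run_start j q i > 0"
      using that by (simp add: run_start_def)
    ultimately show False by linarith
  qed
  have zero: "p = 0 \<longleftrightarrow> p' = 0"
  proof -
    have "0 \<notin> unit_run (run_start m p m) (a m)" if "p \<noteq> 0"
      using pos[of p] p that by auto
    moreover have "0 \<notin> unit_run (run_start m' p' m) (a' m)" if "p' \<noteq> 0"
      using pos[of p'] p' that by auto
    ultimately show ?thesis
      using coords[OF m(1)] by (auto split: if_splits)
  qed
  have main: "a = a' \<and> p = p' \<and> (m = m' \<or> p = 1/2)" if "p \<noteq> 0"
  proof -
    have run: "unit_run (run_start m p i) (a i) = unit_run (run_start m' p' i) (a' i)"
      if "i \<in> {1..n}" for i
      using coords[OF that] zero \<open>p \<noteq> 0\<close> by simp
    have "a i = a' i" for i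
    proof (cases "i \<in> {1..n}")
      case True
      then show ?thesis
        using unit_run_eqD(1)[OF run] by blast
    next
      case False
      then show ?thesis
        using am am' unfolding run_data_def by simp
    qed
    then have aa: "a = a'" by blast
    have st: "run_start m p i = run_start m' p' i" if "i \<in> {1..n}" "0 < a i" for i
      using unit_run_eqD(2)[OF run] that by blast
    show ?thesis
    proof (cases "m = m'")
      case True
      then show ?thesis
        using st[OF m] aa by (simp add: run_start_def)
    next
      case False
      have pp: "p = 1 - p'"
        using st[OF m] False by (simp add: run_start_def)
      have "p = 1/2"
      proof (cases "\<exists>j\<in>{1..n} - {m, m'}. 0 < a j")
        case True
        then obtain j where "j \<in> {1..n}" "j \<noteq> m" "j \<noteq> m'" "0 < a j" by blast
        then show ?thesis
          using st[of j] pp by (simp add: run_start_def)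
      next
        case False
        then have "{i \<in> {1..n}. 0 < a i} \<subseteq> {m, m'}" by blast
        then have "card {i \<in> {1..n}. 0 < a i} \<le> card {m, m'}"
          by (intro card_mono) auto
        also have "\<dots> < 3"
          by (simp add: card_insert_if)
        finally have "p \<le> 1/2" "p' \<le> 1/2"
          using adm adm' aa by (auto simp: admissible_def)
        then show ?thesis
          using pp by simp
      qed
      then show ?thesis
        using aa pp by simp
    qed
  qed
  then show "p = p'" "p \<noteq> 0 \<Longrightarrow> a = a'" "p \<notin> {0, 1/2} \<Longrightarrow> m = m'"
    using zero by auto
  show "m = m'" if aa: "a = a'" and p0: "p = 0"
  proof (rule ccontr)
    assume "m \<noteq> m'"
    \<comment> \<open>On edge \<open>m\<close> the center is one of the \<open>a m\<close> points if
      \<open>m\<close> governs, and an additional one if \<open>m'\<close> does.\<close>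
    have "unit_run 0 (a m) \<union> {0} = unit_run 1 (a m) \<union> {0}"
      using coords[OF m(1)] zero p0 aa \<open>m \<noteq> m'\<close> by (simp add: run_start_def)
    moreover have "unit_run 0 (a m) \<union> {0} = unit_run 0 (a m)"
      using m(2) by (auto simp: unit_run_def image_iff)
    ultimately have "card (unit_run 1 (a m) \<union> {0}) = a m"
      using card_unit_run[of 0 "a m"] by argo
    moreover have "0 \<notin> unit_run 1 (a m)"
      by (auto simp: unit_run_def)
    then have "card (unit_run 1 (a m) \<union> {0}) = Suc (a m)"
      by simp
    ultimately show False by simp
  qed
qed

lemma finite_run_data: "finite (run_data k n)"
proof -
  let ?A = "{a :: nat \<Rightarrow> nat. \<forall>i. (i \<in> {1..n} \<longrightarrow> a i \<in> {..k}) \<and> (i \<notin> {1..n} \<longrightarrow> a i = 0)}"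
  have "run_data k n \<subseteq> ?A \<times> {1..n}"
  proof (clarify, intro conjI)
    fix a m assume am: "(a, m) \<in> run_data k n"
    then show "a \<in> ?A"
      using run_data_bound[OF am] by (auto simp: run_data_def intro: less_imp_le)
    show "m \<in> {1..n}"
      using am by (simp add: run_data_def)
  qed
  moreover have "finite ?A"
    by (rule finite_set_of_finite_funs) auto
  ultimately show ?thesis
    using finite_subset by blast
qed

section \<open>Topology of the space of regular configurations\<close>

lemma continuous_map_star_point:
  assumes "\<kappa> > 0" "i \<in> {1..n}"
  shows "continuous_map (top_of_set {0..\<kappa>}) (star_topology n \<kappa>) (star_point \<kappa> i)"
proof -
  interpret Metric_space "star n" "star_dist \<kappa>"
    by (rule Metric_space_star[OF assms(1)])
  show ?thesis
    unfolding star_topology_def continuous_map_to_metric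
  proof (intro ballI allI impI)
    fix s e :: real assume s: "s \<in> topspace (top_of_set {0..\<kappa>})" and "e > 0"
    have "star_point \<kappa> i t \<in> mball (star_point \<kappa> i s) e" if "t \<in> {0..\<kappa>} \<inter> ball s e" for t
      using that s assms
      by (auto simp: in_mball star_dist_star_point dist_real_def intro!: star_point_in_star)
    then show "\<exists>U. openin (top_of_set {0..\<kappa>}) U \<and> s \<in> U \<and>
        (\<forall>t\<in>U. star_point \<kappa> i t \<in> mball (star_point \<kappa> i s) e)"
      using s \<open>e > 0\<close> by (intro exI[of _ "{0..\<kappa>} \<inter> ball s e"]) auto
  qed
qed

text \<open>The points are indexed independently of the parameter and each moves continuously;
  \<open>p t < 1\<close> prevents collisions at the center.\<close>

lemma continuous_map_run_config:
  assumes \<kappa>: "\<kappa> > 0" "\<kappa> \<ge> real k - 1" and am: "(a, m) \<in> run_data k n"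
    and p: "continuous_on S p" "\<And>t. t \<in> S \<Longrightarrow> 0 \<le> p t \<and> p t < 1"
  shows "continuous_map (top_of_set S) (regular_config_space k n \<kappa>) (\<lambda>t. run_config \<kappa> n a m (p t))"
proof -
  let ?J = "SIGMA i:{1..n}. {..<a i}"
  have "continuous_map (top_of_set S) (config_topology k (star_topology n \<kappa>))
     (\<lambda>t. (\<lambda>x. (case x of (i, j) \<Rightarrow> \<lambda>t. star_point \<kappa> i (run_start m (p t) i + real j)) t) ` ?J)"
  proof (rule continuous_map_into_config)
    show "card ?J = k"
      using am by (simp add: run_data_def)
    fix x assume x: "x \<in> ?J"
    obtain i j where ij: "x = (i, j)" "i \<in> {1..n}" "j < a i"
      using x by auto
    have "run_start m (p t) i + real j \<in> {0..\<kappa>}" if "t \<in> S" for t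
      using unit_run_bound[OF \<kappa>(2) am ij(2), of "p t"] p(2)[OF that] ij(3)
      unfolding unit_run_def by blast
    moreover have "continuous_on S (\<lambda>t. run_start m (p t) i + real j)"
      unfolding run_start_def by (cases "i = m") (auto intro!: continuous_intros p)
    ultimately have "continuous_map (top_of_set S) (top_of_set {0..\<kappa>}) (\<lambda>t. run_start m (p t) i + real j)"
      by (auto simp: continuous_map_in_subtopology)
    from continuous_map_compose[OF this continuous_map_star_point[OF \<kappa>(1) ij(2)]]
    show "continuous_map (top_of_set S) (star_topology n \<kappa>)
        (case x of (i, j) \<Rightarrow> \<lambda>t. star_point \<kappa> i (run_start m (p t) i + real j))"
      by (simp add: ij(1) comp_def)
  next
    fix t assume "t \<in> topspace (top_of_set S)"
    then show "inj_on (\<lambda>x. (case x of (i, j) \<Rightarrow> \<lambda>t. star_point \<kappa> i (run_start m (p t) i + real j)) t) ?J"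
      using inj_on_run_config[OF \<kappa>(1), of "p t" m n a] p(2)
      by (simp add: case_prod_unfold)
  qed auto
  then have "continuous_map (top_of_set S) (config_topology k (star_topology n \<kappa>))
     (\<lambda>t. run_config \<kappa> n a m (p t))"
    by (simp add: run_config_image case_prod_unfold)
  then show ?thesis
    using run_config_in_regular_configs[OF \<kappa> am] p(2)
    by (auto simp: regular_config_space_def continuous_map_in_subtopology)
qed

lemma topspace_regular_config_space:
  assumes "\<kappa> > 0"
  shows "topspace (regular_config_space k n \<kappa>) = regular_configs k n \<kappa>"
proof -
  have "topspace (star_topology n \<kappa>) = star n"
    using Metric_space.topspace_mtopology[OF Metric_space_star[OF assms]] by (simp add: star_topology_def)
  then show ?thesis
    by (auto simp: regular_config_space_def topspace_config_topology regular_configs_def)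
qed

lemma Hausdorff_regular_config_space:
  assumes "\<kappa> > 0"
  shows "Hausdorff_space (regular_config_space k n \<kappa>)"
  using Metric_space.Hausdorff_space_config[OF Metric_space_star[OF assms]]
  by (simp add: regular_config_space_def star_topology_def Hausdorff_space_subtopology)

text \<open>The arcs \<open>p \<in> [l/(l+1), (l+1)/(l+2)]\<close>: \<open>[0, 1/2]\<close> for \<open>l = 0\<close>, and \<open>[1/2, 1)\<close> is cut into
  the others.\<close>

definition arc_param :: "real \<Rightarrow> real" where
  "arc_param u = u / (u + 1)"

lemma arc_param_bounds:
  assumes "0 \<le> u"
  shows "0 \<le> arc_param u" "arc_param u < 1"
  using assms by (auto simp: arc_param_def field_simps)

lemma arc_param_le_half_iff:
  assumes "0 \<le> u"
  shows "arc_param u \<le> 1/2 \<longleftrightarrow> u \<le> 1"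
  using assms by (auto simp: arc_param_def field_simps)

lemma arc_param_eq_iff:
  assumes "0 \<le> u" "0 \<le> v"
  shows "arc_param u = arc_param v \<longleftrightarrow> u = v"
  using assms by (auto simp: arc_param_def field_simps)

lemma arc_param_special_iff:
  assumes "0 \<le> u"
  shows "arc_param u = 0 \<longleftrightarrow> u = 0" "arc_param u = 1/2 \<longleftrightarrow> u = 1"
  using assms by (auto simp: arc_param_def field_simps)

lemma arc_param_surj:
  assumes "0 \<le> p" "p < 1"
  obtains u where "0 \<le> u" "arc_param u = p"
proof
  show "0 \<le> p / (1 - p)" "arc_param (p / (1 - p)) = p"
    using assms by (auto simp: arc_param_def field_simps)
qed

definition arc_index :: "nat \<Rightarrow> nat \<Rightarrow> (((nat \<Rightarrow> nat) \<times> nat) \<times> nat) set" where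
  "arc_index k n = {((a, m), l). (a, m) \<in> run_data k n \<and> (l = 0 \<or> 3 \<le> card {i \<in> {1..n}. 0 < a i})}"

text \<open>Adding \<open>l\<close> before applying \<open>arc_param\<close> makes piece
  \<open>l\<close> end where piece \<open>l + 1\<close> begins.\<close>

definition run_arc :: "real \<Rightarrow> nat \<Rightarrow> ((nat \<Rightarrow> nat) \<times> nat) \<times> nat \<Rightarrow> real \<Rightarrow> (nat \<times> real) set" where
  "run_arc \<kappa> n = (\<lambda>((a, m), l) t. run_config \<kappa> n a m (arc_param (real l + t)))"

lemma admissible_arc:
  assumes "((a, m), l) \<in> arc_index k n" "t \<in> {0..1}"
  shows "admissible n a (arc_param (real l + t))"
  using assms arc_param_bounds[of "real l + t"] arc_param_le_half_iff[of "real l + t"]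
  by (auto simp: arc_index_def admissible_def)

lemma run_arc_eqD:
  assumes \<kappa>: "\<kappa> > 0" "\<kappa> \<ge> real k - 1"
    and i: "((a, m), l) \<in> arc_index k n" "s \<in> {0..1}"
    and j: "((a', m'), l') \<in> arc_index k n" "t \<in> {0..1}"
    and eq: "run_arc \<kappa> n ((a, m), l) s = run_arc \<kappa> n ((a', m'), l') t"
  shows "real l + s = real l' + t" "real l + s \<noteq> 0 \<Longrightarrow> a = a'"
    "real l + s \<notin> {0, 1} \<Longrightarrow> m = m'" "a = a' \<Longrightarrow> real l + s = 0 \<Longrightarrow> m = m'"
proof -
  have am: "(a, m) \<in> run_data k n" "(a', m') \<in> run_data k n"
    using i j by (auto simp: arc_index_def)
  have nn: "0 \<le> real l + s" "0 \<le> real l' + t"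
    using i j by auto
  note D = run_config_eqD[OF \<kappa> am(1) admissible_arc[OF i] am(2) admissible_arc[OF j]]
  have eq': "run_config \<kappa> n a m (arc_param (real l + s)) = run_config \<kappa> n a' m' (arc_param (real l' + t))"
    using eq by (simp add: run_arc_def)
  show "real l + s = real l' + t"
    using D(1)[OF eq'] arc_param_eq_iff[OF nn] by blast
  show "real l + s \<noteq> 0 \<Longrightarrow> a = a'"
    using D(2)[OF eq'] arc_param_special_iff[OF nn(1)] by blast
  show "real l + s \<notin> {0, 1} \<Longrightarrow> m = m'"
    using D(3)[OF eq'] arc_param_special_iff[OF nn(1)] by blast
  show "a = a' \<Longrightarrow> real l + s = 0 \<Longrightarrow> m = m'"
    using D(4)[OF eq'] arc_param_special_iff[OF nn(1)] by blast
qed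

lemma Union_arcs:
  assumes \<kappa>: "\<kappa> > 0" "\<kappa> \<ge> real k - 1"
  shows "regular_configs k n \<kappa> = (\<Union>i\<in>arc_index k n. run_arc \<kappa> n i ` {0..1})"
proof (intro equalityI subsetI)
  fix c assume "c \<in> regular_configs k n \<kappa>"
  then obtain a m p where c: "(a, m) \<in> run_data k n" "0 \<le> p" "p < 1" "c = run_config \<kappa> n a m p"
    using regular_config_run_config[OF \<kappa>(1)] by metis
  obtain a m p where c: "(a, m) \<in> run_data k n" "admissible n a p" "c = run_config \<kappa> n a m p"
  proof (cases "admissible n a p")
    case True
    then show ?thesis using that c by blast
  next
    \<comment> \<open>With two arms and \<open>p > 1/2\<close> the arms exchange roles, which
      replaces \<open>p\<close> by \<open>1 - p\<close>.\<close>
    case False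
    then have "card {i \<in> {1..n}. 0 < a i} < 3" "p > 1/2"
      using c by (auto simp: admissible_def)
    then obtain i where "(a, i) \<in> run_data k n" "c = run_config \<kappa> n a i (1 - p)"
      using run_config_swap[OF c(1), of \<kappa> p] c(4) by metis
    moreover have "admissible n a (1 - p)"
      using c \<open>p > 1/2\<close> by (simp add: admissible_def)
    ultimately show ?thesis using that by blast
  qed
  then obtain u where u: "0 \<le> u" "arc_param u = p"
    using arc_param_surj by (metis admissible_def)
  show "c \<in> (\<Union>i\<in>arc_index k n. run_arc \<kappa> n i ` {0..1})"
  proof (cases "u \<le> 1")
    case True
    then have "((a, m), 0) \<in> arc_index k n" "c = run_arc \<kappa> n ((a, m), 0) u"
      using c u by (auto simp: arc_index_def run_arc_def)
    then show ?thesis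
      using True u by force
  next
    case False
    \<comment> \<open>Here \<open>u > 1\<close> means \<open>p > 1/2\<close>, so admissibility
      provides the three arms that the pieces with \<open>l > 0\<close> require.\<close>
    define l where "l = nat \<lfloor>u\<rfloor>"
    have "u - real l \<in> {0..1}"
      unfolding l_def using u(1) by (auto simp: of_nat_nat) linarith+
    moreover have "((a, m), l) \<in> arc_index k n"
      using c u False arc_param_le_half_iff[OF u(1)] by (auto simp: arc_index_def admissible_def)
    moreover have "c = run_arc \<kappa> n ((a, m), l) (u - real l)"
      using c u by (simp add: run_arc_def)
    ultimately show ?thesis by blast
  qed
next
  fix c assume "c \<in> (\<Union>i\<in>arc_index k n. run_arc \<kappa> n i ` {0..1})"
  then obtain i t where i: "i \<in> arc_index k n" and t: "t \<in> {0..1}" "c = run_arc \<kappa> n i t"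
    by blast
  moreover obtain a m l where "i = ((a, m), l)"
    by (metis surj_pair)
  ultimately have c: "((a, m), l) \<in> arc_index k n" "t \<in> {0..1}" "c = run_arc \<kappa> n ((a, m), l) t"
    by auto
  then have "c = run_config \<kappa> n a m (arc_param (real l + t))" "(a, m) \<in> run_data k n" "0 \<le> real l + t"
    by (auto simp: arc_index_def run_arc_def)
  then show "c \<in> regular_configs k n \<kappa>"
    using run_config_in_regular_configs[OF \<kappa>] arc_param_bounds[of "real l + t"] by simp
qed

text \<open>As \<open>p\<close> tends to 1, at least two of three or more arms run into the center, so that the
  half-open arcs leave every compact set. Bumps at the center detect this.\<close>

lemma locally_finite_arcs:
  assumes \<kappa>: "\<kappa> > 0" "\<kappa> \<ge> real k - 1" and c: "c \<in> regular_configs k n \<kappa>"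
  shows "\<exists>U. openin (regular_config_space k n \<kappa>) U \<and> c \<in> U \<and>
    finite {i \<in> arc_index k n. run_arc \<kappa> n i ` {0..1} \<inter> U \<noteq> {}}"
proof -
  interpret Metric_space "star n" "star_dist \<kappa>"
    by (rule Metric_space_star[OF \<kappa>(1)])
  let ?X = "regular_config_space k n \<kappa>"
  have o: "(0, 0) \<in> star n"
    by (simp add: star_def)
  have cs: "c \<subseteq> star n" "finite c"
    using c by (auto simp: regular_configs_def configs_def)
  \<comment> \<open>Only the center itself can be a point of \<open>c\<close> closer than
    \<open>r\<close> to the center, so the bumps sum to at most \<open>r\<close> on
    \<open>c\<close>.\<close>
  define r where "r = Min (insert 1 (star_dist \<kappa> (0, 0) ` (c - {(0, 0)})))"
  have "star_dist \<kappa> (0, 0) y > 0" if "y \<in> c - {(0, 0)}" for y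
    using that cs o by (intro mdist_pos_less) auto
  then have r: "r > 0"
    using cs by (simp add: r_def)
  have far: "bump (0, 0) r y = 0" if "y \<in> c - {(0, 0)}" for y
  proof -
    have "r \<le> star_dist \<kappa> (0, 0) y"
      using that cs unfolding r_def by (intro Min_le) auto
    then show ?thesis by (simp add: bump_def)
  qed
  have "sum (bump (0, 0) r) c \<le> sum (bump (0, 0) r) {(0, 0)}"
  proof -
    have "sum (bump (0, 0) r) c \<le> sum (bump (0, 0) r) (insert (0, 0) c)"
      using cs by (intro sum_mono2) (auto simp: bump_nonneg)
    also have "\<dots> = sum (bump (0, 0) r) {(0, 0)}"
      using cs far by (intro sum.mono_neutral_right) auto
    finally show ?thesis .
  qed
  then have small: "sum (bump (0, 0) r) c \<le> r"
    using r o by (simp add: bump_def)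
  \<comment> \<open>Two points within \<open>r / 4\<close> of the center contribute at least
    \<open>3/4 * r\<close> each and so reach the threshold \<open>3/2 * r\<close>, which
    \<open>c\<close> stays below.\<close>
  define U where "U = {c \<in> topspace ?X. sum (bump (0, 0) r) c \<in> {..<3/2 * r}}"
  have "continuous_map ?X euclideanreal (sum (bump (0, 0) r))"
    unfolding regular_config_space_def star_topology_def
    by (intro continuous_map_from_subtopology continuous_map_config_bump o)
  then have "openin ?X U"
    unfolding U_def by (rule openin_continuous_map_preimage) simp
  moreover have "c \<in> U"
    using small r c by (simp add: U_def topspace_regular_config_space[OF \<kappa>(1)])
  moreover have "finite {i \<in> arc_index k n. run_arc \<kappa> n i ` {0..1} \<inter> U \<noteq> {}}"
  proof -
    \<comment> \<open>On piece \<open>l\<close> one has \<open>1 - p \<le> 1 / (l + 1)\<close>,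
      which is below \<open>r / 4\<close> for \<open>l > L\<close>.\<close>
    obtain L where L: "inverse (real (Suc L)) < r / 4"
      using reals_Archimedean[of "r / 4"] r by auto
    have "{i \<in> arc_index k n. run_arc \<kappa> n i ` {0..1} \<inter> U \<noteq> {}} \<subseteq> run_data k n \<times> {..L}"
    proof
      fix x assume "x \<in> {i \<in> arc_index k n. run_arc \<kappa> n i ` {0..1} \<inter> U \<noteq> {}}"
      then obtain t where t: "x \<in> arc_index k n" "t \<in> {0..1}" "run_arc \<kappa> n x t \<in> U"
        by blast
      moreover obtain a m l where "x = ((a, m), l)"
        by (metis surj_pair)
      ultimately have x: "x = ((a, m), l)" "((a, m), l) \<in> arc_index k n" "t \<in> {0..1}"
        "run_arc \<kappa> n ((a, m), l) t \<in> U"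
        by auto
      have am: "(a, m) \<in> run_data k n"
        using x by (simp add: arc_index_def)
      have "l \<le> L"
      proof (rule ccontr)
        assume "\<not> l \<le> L"
        then have l: "l > L" by simp
        then have three: "3 \<le> card {i \<in> {1..n}. 0 < a i}"
          using x(2) by (auto simp: arc_index_def)
        let ?A = "{i \<in> {1..n}. 0 < a i}"
        have "card (?A - {m}) = card ?A - 1"
          using am by (intro card_Diff_singleton) (auto simp: run_data_def)
        then have "2 \<le> card (?A - {m})"
          using three by linarith
        then obtain B where B: "B \<subseteq> ?A - {m}" "card B = 2"
          by (meson obtain_subset_with_card_n)
        then obtain i j where ij: "B = {i, j}" "i \<noteq> j"
          by (auto simp: card_2_iff)
        then have i: "i \<in> {1..n}" "0 < a i" "i \<noteq> m" and j: "j \<in> {1..n}" "0 < a j" "j \<noteq> m"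
          using B by auto
        define p where "p = arc_param (real l + t)"
        have p: "0 \<le> p" "p < 1" "1 - p \<le> r / 4"
        proof -
          have nn: "0 \<le> real l + t"
            using x by simp
          then show "0 \<le> p" "p < 1"
            by (simp_all add: p_def arc_param_bounds)
          have "1 - p = inverse (real l + t + 1)"
            using nn by (simp add: p_def arc_param_def field_simps)
          also have "\<dots> \<le> inverse (real (Suc L))"
            using l x(3) by (intro le_imp_inverse_le) auto
          finally show "1 - p \<le> r / 4"
            using L by simp
        qed
        let ?c = "run_config \<kappa> n a m p"
        have mem: "star_point \<kappa> q (1 - p) \<in> ?c" if "q \<in> {1..n}" "0 < a q" "q \<noteq> m" for q
        proof -
          have "1 - p \<in> unit_run (run_start m p q) (a q)"
            using that by (force simp: unit_run_def run_start_def)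
          then show ?thesis
            using that unfolding run_config_def by blast
        qed
        have big: "bump (0, 0) r (star_point \<kappa> q (1 - p)) \<ge> 3/4 * r" if "q \<in> {1..n}" for q
        proof -
          have "star_dist \<kappa> (star_point \<kappa> q 0) (star_point \<kappa> q (1 - p)) = 1 - p"
            using that \<kappa>(1) p by (subst star_dist_star_point) auto
          then show ?thesis
            using p by (simp add: bump_def star_point_def)
        qed
        have ne: "star_point \<kappa> i (1 - p) \<noteq> star_point \<kappa> j (1 - p)"
          using i j ij(2) \<kappa>(1) p by (simp add: star_point_eq_iff)
        have "3/2 * r \<le> sum (bump (0, 0) r) {star_point \<kappa> i (1 - p), star_point \<kappa> j (1 - p)}"
          using ne big[OF i(1)] big[OF j(1)] by simp
        also have "\<dots> \<le> sum (bump (0, 0) r) ?c"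
          using mem[OF i] mem[OF j] by (intro sum_mono2) (auto simp: bump_nonneg run_config_def)
        finally show False
          using x(4) by (simp add: U_def run_arc_def p_def)
      qed
      then show "x \<in> run_data k n \<times> {..L}"
        using x am by simp
    qed
    then show ?thesis
      using finite_run_data by (rule finite_subset[OF _ finite_cartesian_product]) simp
  qed
  ultimately show ?thesis by blast
qed

text \<open>An arc supplies the 1-simplex that makes the dimension exactly one. For smaller
  \<open>n\<close> or \<open>k\<close> no two edges can be occupied as \<open>run_data\<close>
  demands, and the space is empty.\<close>

lemma arc_index_nonempty:
  assumes "n \<ge> 2" "k \<ge> 2"
  shows "arc_index k n \<noteq> {}"
proof -
  define a :: "nat \<Rightarrow> nat" where "a i = (if i = 1 then k - 1 else if i = 2 then 1 else 0)" for i
  have "sum a {1..n} = sum a {1, 2}"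
    using assms by (intro sum.mono_neutral_right) (auto simp: a_def)
  then have "(a, 1) \<in> run_data k n"
    using assms by (auto simp: run_data_def a_def intro!: bexI[of _ 2])
  then show ?thesis
    by (auto simp: arc_index_def)
qed

theorem lemma1:
  fixes n k :: nat and \<kappa> :: real
  assumes "\<kappa> > 0" and "\<kappa> \<ge> real k - 1"
  shows "topological_graph (regular_config_space k n \<kappa>) \<and>
    (n \<ge> 2 \<and> k \<ge> 2 \<longrightarrow> polyhedron_of_dim 1 (regular_config_space k n \<kappa>))"
proof -
  note \<kappa> = assms
  have "topological_graph (regular_config_space k n \<kappa>) \<and>
    (arc_index k n \<noteq> {} \<longrightarrow> polyhedron_of_dim 1 (regular_config_space k n \<kappa>))"
  proof (rule graph_of_arcs[where \<gamma> = "run_arc \<kappa> n"])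
    show "Hausdorff_space (regular_config_space k n \<kappa>)"
      by (rule Hausdorff_regular_config_space[OF \<kappa>(1)])
    have "arc_index k n \<subseteq> run_data k n \<times> UNIV"
      by (auto simp: arc_index_def)
    then show "countable (arc_index k n)"
      using countable_finite[OF finite_run_data] by (rule countable_subset[OF _ countable_SIGMA]) simp
    show "topspace (regular_config_space k n \<kappa>) = (\<Union>i\<in>arc_index k n. run_arc \<kappa> n i ` {0..1})"
      using topspace_regular_config_space[OF \<kappa>(1)] Union_arcs[OF \<kappa>] by simp
    show "\<exists>U. openin (regular_config_space k n \<kappa>) U \<and> c \<in> U \<and>
        finite {i \<in> arc_index k n. run_arc \<kappa> n i ` {0..1} \<inter> U \<noteq> {}}"
      if "c \<in> topspace (regular_config_space k n \<kappa>)" for c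
      using that locally_finite_arcs[OF \<kappa>] topspace_regular_config_space[OF \<kappa>(1)] by simp
  next
    fix i assume i: "i \<in> arc_index k n"
    obtain a m l where [simp]: "i = ((a, m), l)"
      by (metis surj_pair)
    have "continuous_on {0..1} (\<lambda>t. arc_param (real l + t))"
      unfolding arc_param_def by (intro continuous_intros) auto
    then have "continuous_map (top_of_set {0..1}) (regular_config_space k n \<kappa>)
        (\<lambda>t. run_config \<kappa> n a m (arc_param (real l + t)))"
      using i arc_param_bounds by (intro continuous_map_run_config[OF \<kappa>]) (auto simp: arc_index_def)
    then show "continuous_map (top_of_set {0..1}) (regular_config_space k n \<kappa>) (run_arc \<kappa> n i)"
      by (simp add: run_arc_def)
    show "run_arc \<kappa> n i 0 \<noteq> run_arc \<kappa> n i 1"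
      using run_arc_eqD(1)[OF \<kappa>, of a m l n 0 a m l 1] i by auto
    fix j assume j: "j \<in> arc_index k n"
    obtain a' m' l' where [simp]: "j = ((a', m'), l')"
      by (metis surj_pair)
    have D: "real l + s = real l' + t" "real l + s \<noteq> 0 \<Longrightarrow> a = a'"
      "real l + s \<notin> {0, 1} \<Longrightarrow> m = m'" "a = a' \<Longrightarrow> real l + s = 0 \<Longrightarrow> m = m'"
      if "s \<in> {0..1}" "t \<in> {0..1}" "run_arc \<kappa> n i s = run_arc \<kappa> n j t" for s t
      using run_arc_eqD[OF \<kappa>, of a m l n s a' m' l' t] that i j by auto
    show "i = j \<and> s = t \<or> s \<in> {0, 1} \<and> t \<in> {0, 1}"
      if st: "s \<in> {0..1}" "t \<in> {0..1}" "run_arc \<kappa> n i s = run_arc \<kappa> n j t" for s t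
    proof -
      have eq: "real l + s = real l' + t"
        using D(1)[OF st] .
      \<comment> \<open>For different \<open>l\<close> equal parameters force adjacent pieces and a
        common end. For \<open>l = l'\<close> the data agree unless the parameter is 0 or 1, that
        is, \<open>p\<close> is 0 or 1/2, and then the point is an end.\<close>
      consider "l = l'" | "l < l'" | "l' < l" by linarith
      then show ?thesis
      proof cases
        case 1
        have "s \<in> {0, 1}" if "real l + s \<in> {0, 1}"
        proof -
          have "l = 0 \<or> l = 1"
            using that st(1) by auto
          then show ?thesis
            using that st(1) by auto
        qed
        then show ?thesis
          using 1 eq D(2,3)[OF st] by auto
      next
        case 2
        then have "real l + 1 \<le> real l'" by linarith
        then have "s = 1" "t = 0"
          using eq st(1,2) unfolding atLeastAtMost_iff by linarith+
        then show ?thesis by simp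
      next
        case 3
        then have "real l' + 1 \<le> real l" by linarith
        then have "s = 0" "t = 1"
          using eq st(1,2) unfolding atLeastAtMost_iff by linarith+
        then show ?thesis by simp
      qed
    qed
    show "i = j" if ends: "{run_arc \<kappa> n i 0, run_arc \<kappa> n i 1} = {run_arc \<kappa> n j 0, run_arc \<kappa> n j 1}"
    proof -
      consider "run_arc \<kappa> n i 0 = run_arc \<kappa> n j 0" "run_arc \<kappa> n i 1 = run_arc \<kappa> n j 1"
        | "run_arc \<kappa> n i 0 = run_arc \<kappa> n j 1" "run_arc \<kappa> n i 1 = run_arc \<kappa> n j 0"
        using ends unfolding doubleton_eq_iff by blast
      then show ?thesis
      proof cases
        case 1
        \<comment> \<open>The far end has parameter \<open>l + 1\<close>, which is not 0, so it
          fixes \<open>a\<close> and \<open>l\<close>. It also fixes \<open>m\<close> unless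
          \<open>l = 0\<close>, when it lies at \<open>p = 1/2\<close>; then the near end at
          \<open>p = 0\<close> fixes \<open>m\<close>, as \<open>a\<close> is already known.\<close>
        have "a = a'" "l = l'"
          using D(1,2)[OF _ _ 1(2)] by auto
        moreover have "m = m'"
          using D(3)[OF _ _ 1(2)] D(4)[OF _ _ 1(1)] \<open>a = a'\<close> by (cases "l = 0") auto
        ultimately show ?thesis by simp
      next
        \<comment> \<open>Matching opposite ends would require both \<open>l = l' + 1\<close> and
          \<open>l' = l + 1\<close>.\<close>
        case 2
        then show ?thesis
          using D(1)[OF _ _ 2(1)] D(1)[OF _ _ 2(2)] by auto
      qed
    qed
  qed
  then show ?thesis
    using arc_index_nonempty by blast
qed

end
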